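(* There is a polynomial-time algorithm that, given $n$ jobs with weights $w_i>0$, expected sizes $\mu_i\ge0$, costs $c_i\ge0$ and a budget $C$, outputs a set $S\subseteq[n]$ with $\sum_{i\in S}c_i\le 3C$ and $$\sum_{i,j\notin S,\ j>i}\min(w_j\mu_i,w_i\mu_j)+\sum_{i\notin S}w_i\mu_i\ \le\ 3\,\mathcal{G}^*(C).$$ That is, the outlier problem $\mathcal{G}^*(C)$ admits a $3$-approximation that violates the cost budget $C$ by a factor of $3$.
   Context: The outlier problem $\mathcal{G}^*(C)$ for weighted completion time scheduling: choose a set $S$ of jobs (outliers, to be discarded) with $\sum_{i\in S}c_i\le C$ so as to minimize $\sum_{i,j\notin S,\ j>i}\min(w_j\mu_i,w_i\mu_j)+\sum_{i\notin S}w_i\mu_i$ (the optimal expected weighted completion time of the remaining jobs, whose sizes are random with means $\mu_i$); $\mathcal{G}^*(C)$ denotes the optimal value. *)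

theory Defs
  imports Complex_Main "HOL-Library.Log_Nat" "HOL-Computational_Algebra.Polynomial"
begin

section \<open>Model of computation\<close>

text \<open>
  A random access machine with logarithmic cost, programmed by while-programs over finitely many
  named arrays of integers (a scalar is one cell of an array). Array indices are computed
  values, so indirect addressing is available. The cost of a step is the number of bits of
  the integers it handles, addresses included. Hence, up to polynomial factors, the running
  time is that of a Turing machine, although numbers may grow through multiplication.
\<close>

type_synonym name = string
type_synonym store = "name \<Rightarrow> int \<Rightarrow> int"

text \<open>Length of the binary representation, with one additional bit for the sign.\<close>

definition bit_size :: "int \<Rightarrow> nat" where
  "bit_size k = floorlog 2 (nat \<bar>k\<bar>) + 1"

datatype aexp =
    Const int
  | Cell name aexp
  | Add aexp aexp
  | Sub aexp aexp
  | Mul aexp aexp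
  | Div aexp aexp

datatype bexp =
    Less aexp aexp
  | Neg bexp
  | Conj bexp bexp

datatype com =
    Skip
  | Assign name aexp aexp  \<comment> \<open>\<open>Assign x a e\<close> stands for \<open>x[a] := e\<close>\<close>
  | Seq com com
  | Cond bexp com com
  | While bexp com

fun aval :: "aexp \<Rightarrow> store \<Rightarrow> int" where
  "aval (Const k) s = k"
| "aval (Cell x a) s = s x (aval a s)"
| "aval (Add a b) s = aval a s + aval b s"
| "aval (Sub a b) s = aval a s - aval b s"
| "aval (Mul a b) s = aval a s * aval b s"
| "aval (Div a b) s = aval a s div aval b s"

text \<open>Every node of an expression is charged the length of its value.\<close>

fun acost :: "aexp \<Rightarrow> store \<Rightarrow> nat" where
  "acost (Const k) s = bit_size k"
| "acost (Cell x a) s = acost a s + bit_size (aval (Cell x a) s)"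
| "acost (Add a b) s = acost a s + acost b s + bit_size (aval (Add a b) s)"
| "acost (Sub a b) s = acost a s + acost b s + bit_size (aval (Sub a b) s)"
| "acost (Mul a b) s = acost a s + acost b s + bit_size (aval (Mul a b) s)"
| "acost (Div a b) s = acost a s + acost b s + bit_size (aval (Div a b) s)"

fun bval :: "bexp \<Rightarrow> store \<Rightarrow> bool" where
  "bval (Less a b) s \<longleftrightarrow> aval a s < aval b s"
| "bval (Neg b) s \<longleftrightarrow> \<not> bval b s"
| "bval (Conj b c) s \<longleftrightarrow> bval b s \<and> bval c s"

fun bcost :: "bexp \<Rightarrow> store \<Rightarrow> nat" where
  "bcost (Less a b) s = acost a s + acost b s + 1"
| "bcost (Neg b) s = bcost b s + 1"
| "bcost (Conj b c) s = bcost b s + bcost c s + 1"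

text \<open>
  \<open>run P s t s'\<close>: program \<open>P\<close>, started in store \<open>s\<close>, halts in store \<open>s'\<close> with total cost \<open>t\<close>.
\<close>

inductive run :: "com \<Rightarrow> store \<Rightarrow> nat \<Rightarrow> store \<Rightarrow> bool" where
  Skip: "run Skip s 1 s"
| Assign: "run (Assign x a e) s (acost a s + acost e s + 1)
             (s(x := (s x)(aval a s := aval e s)))"
| Seq: "run P s t s' \<Longrightarrow> run Q s' u s'' \<Longrightarrow> run (Seq P Q) s (t + u) s''"
| CondTrue: "bval b s \<Longrightarrow> run P s t s' \<Longrightarrow> run (Cond b P Q) s (bcost b s + t) s'"
| CondFalse: "\<not> bval b s \<Longrightarrow> run Q s t s' \<Longrightarrow> run (Cond b P Q) s (bcost b s + t) s'"
| WhileFalse: "\<not> bval b s \<Longrightarrow> run (While b P) s (bcost b s) s"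
| WhileTrue: "bval b s \<Longrightarrow> run P s t s' \<Longrightarrow> run (While b P) s' u s'' \<Longrightarrow>
                run (While b P) s (bcost b s + t + u) s''"

inductive_cases SkipE: "run Skip s t s'"
  and AssignE: "run (Assign x a e) s t s'"
  and SeqE: "run (Seq P Q) s t s'"
  and CondE: "run (Cond b P Q) s t s'"
  and WhileE: "run (While b P) s t s'"

text \<open>
  Programs are deterministic, so the existence of a halting run with given cost and result is
  total correctness of the program with that running time.
\<close>

lemma run_deterministic:
  "run P s t s' \<Longrightarrow> run P s u s'' \<Longrightarrow> u = t \<and> s'' = s'"
proof (induction arbitrary: u s'' rule: run.induct)
  case (Skip s)
  then show ?case by (auto elim: SkipE)
next
  case (Assign x a e s)
  then show ?case by (auto elim: AssignE)
next
  case (Seq P s t s' Q v r)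
  from Seq.prems show ?case by (rule SeqE) (use Seq.IH in blast)
next
  case (CondTrue b s P t s' Q)
  from CondTrue.prems show ?case by (rule CondE) (use CondTrue in blast)+
next
  case (CondFalse b s Q t s' P)
  from CondFalse.prems show ?case by (rule CondE) (use CondFalse in blast)+
next
  case (WhileFalse b s P)
  from WhileFalse.prems show ?case by (rule WhileE) (use WhileFalse in blast)+
next
  case (WhileTrue b s P t s' v r)
  from WhileTrue.prems show ?case by (rule WhileE) (use WhileTrue in blast)+
qed

text \<open>The input occupies the cells \<open>0, 1, \<dots>\<close> of the array \<open>in\<close>; all other cells contain \<open>0\<close>.\<close>

definition initial_store :: "int list \<Rightarrow> store" where
  "initial_store xs x a =
     (if x = ''in'' \<and> 0 \<le> a \<and> a < int (length xs) then xs ! nat a else 0)"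

definition input_size :: "int list \<Rightarrow> nat" where
  "input_size xs = (\<Sum>k\<leftarrow>xs. bit_size k)"

text \<open>The output is the characteristic vector of \<open>S \<subseteq> {1..n}\<close> in the cells \<open>1, \<dots>, n\<close> of \<open>out\<close>.\<close>

definition outputs_set :: "nat \<Rightarrow> store \<Rightarrow> nat set \<Rightarrow> bool" where
  "outputs_set n s S \<longleftrightarrow>
     S \<subseteq> {1..n} \<and> (\<forall>i\<in>{1..n}. s ''out'' (int i) = (if i \<in> S then 1 else 0))"


section \<open>The outlier problem for weighted completion time scheduling\<close>

definition completion_cost ::
  "nat \<Rightarrow> (nat \<Rightarrow> rat) \<Rightarrow> (nat \<Rightarrow> rat) \<Rightarrow> nat set \<Rightarrow> rat" where
  "completion_cost n w \<mu> S =
     (\<Sum>i\<in>{1..n} - S. \<Sum>j\<in>{j \<in> {1..n} - S. j > i}. min (w j * \<mu> i) (w i * \<mu> j))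
     + (\<Sum>i\<in>{1..n} - S. w i * \<mu> i)"

text \<open>For \<open>C \<ge> 0\<close> the minimum is over a finite nonempty set, as \<open>S = {}\<close> is within the budget.\<close>

definition G_star ::
  "nat \<Rightarrow> (nat \<Rightarrow> rat) \<Rightarrow> (nat \<Rightarrow> rat) \<Rightarrow> (nat \<Rightarrow> rat) \<Rightarrow> rat \<Rightarrow> rat" where
  "G_star n w \<mu> c C =
     Min {completion_cost n w \<mu> S | S. S \<subseteq> {1..n} \<and> (\<Sum>i\<in>S. c i) \<le> C}"

text \<open>Rational numbers are given by numerator and denominator in lowest terms.\<close>

definition encode_rat :: "rat \<Rightarrow> int list" where
  "encode_rat q = [fst (quotient_of q), snd (quotient_of q)]"

definition encode_instance ::
  "nat \<Rightarrow> (nat \<Rightarrow> rat) \<Rightarrow> (nat \<Rightarrow> rat) \<Rightarrow> (nat \<Rightarrow> rat) \<Rightarrow> rat \<Rightarrow> int list" where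
  "encode_instance n w \<mu> c C =
     int n # encode_rat C @
     concat (map (\<lambda>i. encode_rat (w i) @ encode_rat (\<mu> i) @ encode_rat (c i)) [1..<Suc n])"

end

theory Submission
  imports Defs
begin

text \<open>
  The algorithm is a primal-dual one. Clear denominators and write the objective as a sum of
  \<open>A e\<close> over the pairs \<open>e = (i, j)\<close>, \<open>i \<le> j\<close>, with both ends outside \<open>S\<close>. For a multiplier
  \<open>2 g / B\<close> of the budget constraint, raise a dual variable \<open>y e \<le> A e\<close> for one pair after the
  other until it is saturated or one end \<open>i\<close> has no slack left, the slack of \<open>i\<close> being initially
  \<open>2 g K i / B\<close>; then discard the jobs without slack. As every pair has at most two ends, the
  resulting \<open>S\<close> satisfies \<open>B cost S + g K S \<le> B cost T + 2 g B\<close> for every \<open>T\<close> within the budget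
  \<open>B\<close>. If \<open>g \<ge> cost T\<close>, then \<open>K S \<le> 3 B\<close>, and if \<open>g \<le> cost T\<close>, then \<open>cost S \<le> 3 cost T\<close>.
  Binary search finds a \<open>g\<close> whose \<open>S\<close> costs at most \<open>3 B\<close> while the \<open>S\<close> of \<open>g - 1\<close> costs more;
  the latter forces \<open>g \<le> cost T\<close> for an optimal \<open>T\<close>.
\<close>

section \<open>Total correctness with polynomial running time\<close>

text \<open>In a store with entries below \<open>2 ^ l\<close> in absolute value,
  \<open>nodes e * (l + 1)\<close> bounds the length of the value of \<open>e\<close>. A constant
  pays for its absolute value, which is crude but depends on the program text only.\<close>

fun nodes :: "aexp \<Rightarrow> nat" where
  "nodes (Const k) = nat \<bar>k\<bar> + 1"
| "nodes (Cell x a) = nodes a + 1"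
| "nodes (Add a b) = nodes a + nodes b"
| "nodes (Sub a b) = nodes a + nodes b"
| "nodes (Mul a b) = nodes a + nodes b"
| "nodes (Div a b) = nodes a + nodes b"

fun aweight :: "aexp \<Rightarrow> nat" where
  "aweight (Const k) = nodes (Const k) + 1"
| "aweight (Cell x a) = aweight a + nodes (Cell x a) + 1"
| "aweight (Add a b) = aweight a + aweight b + nodes (Add a b) + 1"
| "aweight (Sub a b) = aweight a + aweight b + nodes (Sub a b) + 1"
| "aweight (Mul a b) = aweight a + aweight b + nodes (Mul a b) + 1"
| "aweight (Div a b) = aweight a + aweight b + nodes (Div a b) + 1"

fun bweight :: "bexp \<Rightarrow> nat" where
  "bweight (Less a b) = aweight a + aweight b + 1"
| "bweight (Neg b) = bweight b + 1"
| "bweight (Conj b c) = bweight b + bweight c + 1"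

text \<open>\<open>m\<close> stands for the number of iterations of any one loop. A conditional pays
  for both branches, as a sum, unlike a maximum, stays polynomial in \<open>m\<close>.\<close>

fun time_bound :: "nat \<Rightarrow> com \<Rightarrow> nat" where
  "time_bound m Skip = 1"
| "time_bound m (Assign x a e) = aweight a + aweight e + 1"
| "time_bound m (Seq P Q) = time_bound m P + time_bound m Q"
| "time_bound m (Cond b P Q) = bweight b + time_bound m P + time_bound m Q"
| "time_bound m (While b P) = m * (bweight b + time_bound m P) + bweight b"

fun assigned :: "com \<Rightarrow> name set" where
  "assigned Skip = {}"
| "assigned (Assign x a e) = {x}"
| "assigned (Seq P Q) = assigned P \<union> assigned Q"
| "assigned (Cond b P Q) = assigned P \<union> assigned Q"
| "assigned (While b P) = assigned P"

definition bounded :: "nat \<Rightarrow> store \<Rightarrow> bool" where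
  "bounded l s \<longleftrightarrow> (\<forall>x a. \<bar>s x a\<bar> < 2 ^ l)"

definition agree :: "com \<Rightarrow> store \<Rightarrow> store \<Rightarrow> bool" where
  "agree P s s' \<longleftrightarrow> (\<forall>x. x \<notin> assigned P \<longrightarrow> s' x = s x)"

text \<open>The single parameter \<open>l\<close> bounds the length of all stored numbers and the number of
  iterations of every loop; then the running time depends on \<open>l\<close> and the program text only.\<close>

definition spec :: "nat \<Rightarrow> store \<Rightarrow> com \<Rightarrow> (store \<Rightarrow> bool) \<Rightarrow> bool" where
  "spec l s P Q \<longleftrightarrow> (bounded l s \<longrightarrow>
     (\<exists>t s'. run P s t s' \<and> t \<le> time_bound l P * (l + 1) \<and> bounded l s' \<and> Q s'))"

section \<open>Lengths of values and costs of expressions\<close>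

lemma bit_size_le: "\<bar>v\<bar> < 2 ^ e \<Longrightarrow> bit_size v \<le> e + 1"
  unfolding bit_size_def
  by (simp add: floorlog_leI nat_less_iff)

lemma less_bit_size: "\<bar>v\<bar> < 2 ^ bit_size v"
proof -
  have "nat \<bar>v\<bar> < 2 ^ floorlog 2 (nat \<bar>v\<bar>)" 
    using floorlog_bounds[of "nat \<bar>v\<bar>" 2]
    by (cases "v = 0") auto
  then have "\<bar>v\<bar> < 2 ^ floorlog 2 (nat \<bar>v\<bar>)"
    by (simp add: nat_less_iff)
  then show ?thesis unfolding bit_size_def by simp
qed

lemma nodes_pos: "nodes e \<ge> 1"
  by (induction e) auto

text \<open>Rounding down is harmless: for \<open>a \<le> 0 < b\<close> the integer \<open>a\<close>
  itself lies below the quotient. Division by zero yields 0. So \<open>Div\<close> never lengthens a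
  number.\<close>

lemma abs_div_le: "\<bar>a div b\<bar> \<le> \<bar>a\<bar>" for a b :: int
proof (cases "b = 0")
  case False
  have pos: "0 \<le> x div y \<and> x div y \<le> x" if "x \<ge> 0" "y > 0" for x y :: int
    using that by (smt (verit) div_by_1 pos_imp_zdiv_nonneg_iff zdiv_mono2)
  have neg: "x div y \<ge> x \<and> x div y \<le> 0" if "x \<le> 0" "y > 0" for x y :: int
  proof -
    have "x * y \<le> x * 1" using that by (intro mult_left_mono_neg) auto
    then have "x * y div y \<le> x div y" using that by (intro zdiv_mono1) auto
    then show ?thesis using that by (simp add: div_nonpos_pos_le0)
  qed
  consider "b > 0" | "b < 0" using False by linarith
  then show ?thesis
  proof cases
    case 1 then show ?thesis using pos[of a b] neg[of a b] by linarith
  next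
    case 2
    have "a div b = (-a) div (-b)" by simp
    then show ?thesis using pos[of "-a" "-b"] neg[of "-a" "-b"] 2 by linarith
  qed
qed simp

text \<open>Expand \<open>(2 ^ a - 1) * (2 ^ b - 1) \<ge> 1\<close>. This lets sums be treated like
  products, with exponents added.\<close>

lemma add_power_le: "(2::int) ^ a + 2 ^ b \<le> 2 ^ (a + b)" if "a \<ge> 1" "b \<ge> 1"
proof -
  have "(2::int) ^ 1 \<le> 2 ^ a" "(2::int) ^ 1 \<le> 2 ^ b" using that by (intro power_increasing; simp)+
  then have "(2 ^ a - 1) * (2 ^ b - 1) \<ge> (1::int) * 1" by (intro mult_mono) auto
  then show ?thesis by (simp add: power_add algebra_simps)
qed

text \<open>The factor \<open>l + 1\<close> instead of \<open>l\<close> keeps the exponents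
  positive, as \<open>add_power_le\<close> requires. A cell contains a number below
  \<open>2 ^ l\<close> whatever its address.\<close>

lemma aval_bound: "bounded l s \<Longrightarrow> \<bar>aval e s\<bar> < 2 ^ (nodes e * (l + 1))"
proof (induction e)
  case (Const k)
  have "int (nat \<bar>k\<bar>) < int (2 ^ nat \<bar>k\<bar>)" by (rule of_nat_less_iff[THEN iffD2]) (rule less_exp)
  then have "\<bar>k\<bar> < 2 ^ nat \<bar>k\<bar>" by (simp only: int_nat_eq) simp
  also have "(2::int) ^ nat \<bar>k\<bar> \<le> 2 ^ (nodes (Const k) * (l + 1))"
    by (intro power_increasing) auto
  finally show ?case by simp
next
  case (Cell x a)
  have "\<bar>aval (Cell x a) s\<bar> < 2 ^ l" using Cell.prems by (simp add: bounded_def)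
  also have "(2::int) ^ l \<le> 2 ^ (nodes (Cell x a) * (l + 1))"
    by (intro power_increasing) auto
  finally show ?case .
next
  case (Add a b)
  have "\<bar>aval (Add a b) s\<bar> < 2 ^ (nodes a * (l + 1)) + 2 ^ (nodes b * (l + 1))"
    using Add by simp
  also have "(2::int) ^ (nodes a * (l + 1)) + 2 ^ (nodes b * (l + 1))
      \<le> 2 ^ (nodes a * (l + 1) + nodes b * (l + 1))"
    using nodes_pos[of a] nodes_pos[of b] by (intro add_power_le) auto
  finally show ?case by (simp add: algebra_simps)
next
  case (Sub a b)
  have "\<bar>aval (Sub a b) s\<bar> < 2 ^ (nodes a * (l + 1)) + 2 ^ (nodes b * (l + 1))"
    using Sub by simp
  also have "(2::int) ^ (nodes a * (l + 1)) + 2 ^ (nodes b * (l + 1))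
      \<le> 2 ^ (nodes a * (l + 1) + nodes b * (l + 1))"
    using nodes_pos[of a] nodes_pos[of b] by (intro add_power_le) auto
  finally show ?case by (simp add: algebra_simps)
next
  case (Mul a b)
  have "\<bar>aval (Mul a b) s\<bar> < 2 ^ (nodes a * (l + 1)) * 2 ^ (nodes b * (l + 1))"
    using Mul by (simp add: abs_mult mult_strict_mono)
  then show ?case by (simp add: algebra_simps power_add)
next
  case (Div a b)
  have "\<bar>aval (Div a b) s\<bar> \<le> \<bar>aval a s\<bar>" by (simp add: abs_div_le)
  also have "\<dots> < 2 ^ (nodes a * (l + 1))" using Div by simp
  also have "(2::int) ^ (nodes a * (l + 1)) \<le> 2 ^ (nodes (Div a b) * (l + 1))"
    by (intro power_increasing mult_right_mono) auto
  finally show ?case .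
qed

lemma acost_bound: "bounded l s \<Longrightarrow> acost e s \<le> aweight e * (l + 1)"
proof -
  assume b: "bounded l s"
  \<comment> \<open>The sign bit counted by \<open>bit_size\<close> is absorbed by one further
    \<open>l + 1\<close>, the \<open>+ 1\<close> in \<open>aweight\<close>.\<close>
  have n: "bit_size (aval e s) \<le> nodes e * (l + 1) + (l + 1)" for e
    using bit_size_le[OF aval_bound[OF b, of e]] by linarith
  show ?thesis
  proof (induction e)
    case (Const k)
    show ?case using n[of "Const k"] by (simp add: algebra_simps)
  next
    case (Cell x a)
    then show ?case using n[of "Cell x a"] by (simp add: algebra_simps)
  next
    case (Add a b)
    then show ?case using n[of "Add a b"] by (simp add: algebra_simps)
  next
    case (Sub a b)
    then show ?case using n[of "Sub a b"] by (simp add: algebra_simps)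
  next
    case (Mul a b)
    then show ?case using n[of "Mul a b"] by (simp add: algebra_simps)
  next
    case (Div a b)
    then show ?case using n[of "Div a b"] by (simp add: algebra_simps)
  qed
qed

lemma bcost_bound: "bounded l s \<Longrightarrow> bcost b s \<le> bweight b * (l + 1)"
proof (induction b)
  case (Less a b)
  then show ?case using acost_bound[of l s a] acost_bound[of l s b] by (simp add: algebra_simps)
qed (auto simp: algebra_simps)

section \<open>Proof rules for commands\<close>

lemma run_agree: "run P s t s' \<Longrightarrow> agree P s s'"
  by (induction rule: run.induct) (auto simp: agree_def)

text \<open>The frame condition \<open>agree\<close> comes for free, so postconditions need to
  mention only what a command changes.\<close>

lemma spec_conseq:
  "spec l s P Q \<Longrightarrow> (\<And>s'. agree P s s' \<Longrightarrow> bounded l s' \<Longrightarrow> Q s' \<Longrightarrow> R s') \<Longrightarrow> spec l s P R"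
  unfolding spec_def using run_agree by blast

lemma spec_Skip: "Q s \<Longrightarrow> spec l s Skip Q"
  unfolding spec_def by (auto intro!: exI run.Skip)

lemma spec_Assign:
  assumes "\<bar>aval e s\<bar> < 2 ^ l" "Q (s(x := (s x)(aval a s := aval e s)))"
  shows "spec l s (Assign x a e) Q"
  unfolding spec_def
proof (intro impI exI conjI)
  assume b: "bounded l s"
  show "run (Assign x a e) s (acost a s + acost e s + 1) (s(x := (s x)(aval a s := aval e s)))"
    by (rule run.Assign)
  show "acost a s + acost e s + 1 \<le> time_bound l (Assign x a e) * (l + 1)"
    using acost_bound[OF b, of a] acost_bound[OF b, of e] by (simp add: algebra_simps)
  show "bounded l (s(x := (s x)(aval a s := aval e s)))"
    using b assms(1) by (auto simp: bounded_def)
qed (use assms(2) in simp)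

lemma spec_Seq:
  "spec l s P (\<lambda>s'. spec l s' P' Q) \<Longrightarrow> spec l s (Seq P P') Q"
  unfolding spec_def
  apply clarsimp
  subgoal premises p for t s' t' s''
    using p by (intro exI[of _ "t + t'"] exI[of _ s''] conjI run.Seq) (auto simp: algebra_simps)
  done

lemma spec_Cond:
  assumes "bval b s \<Longrightarrow> spec l s P Q" "\<not> bval b s \<Longrightarrow> spec l s P' Q"
  shows "spec l s (Cond b P P') Q"
  unfolding spec_def
proof
  assume bs: "bounded l s"
  note c = bcost_bound[OF bs, of b]
  show "\<exists>t s'. run (Cond b P P') s t s' \<and> t \<le> time_bound l (Cond b P P') * (l + 1) \<and>
      bounded l s' \<and> Q s'"
  proof (cases "bval b s")
    case True
    then obtain t s' where "run P s t s'" "t \<le> time_bound l P * (l + 1)" "bounded l s'" "Q s'"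
      using assms(1) bs unfolding spec_def by blast
    with True c show ?thesis
      by (intro exI[of _ "bcost b s + t"] exI[of _ s'] conjI run.CondTrue)
        (auto simp: algebra_simps)
  next
    case False
    then obtain t s' where "run P' s t s'" "t \<le> time_bound l P' * (l + 1)" "bounded l s'" "Q s'"
      using assms(2) bs unfolding spec_def by blast
    with False c show ?thesis
      by (intro exI[of _ "bcost b s + t"] exI[of _ s'] conjI run.CondFalse)
        (auto simp: algebra_simps)
  qed
qed

text \<open>\<open>I k\<close> carries a variant: at most \<open>k\<close> iterations remain. As
  \<open>step\<close> yields a predecessor of \<open>k\<close>, the guard is false at
  \<open>k = 0\<close>, and \<open>l\<close> iterations suffice.\<close>

lemma spec_While:
  assumes I: "I k s" "k \<le> l"
    and step: "\<And>k s'. agree P s s' \<Longrightarrow> I k s' \<Longrightarrow> bval b s' \<Longrightarrow> bounded l s' \<Longrightarrow>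
      \<exists>k'. k = Suc k' \<and> spec l s' P (I k')"
    and post: "\<And>k s'. agree P s s' \<Longrightarrow> I k s' \<Longrightarrow> \<not> bval b s' \<Longrightarrow> bounded l s' \<Longrightarrow> Q s'"
  shows "spec l s (While b P) Q"
proof -
  have *: "\<exists>t s''. run (While b P) s' t s'' \<and>
      t \<le> (k * (bweight b + time_bound l P) + bweight b) * (l + 1) \<and> bounded l s'' \<and> Q s''"
    if "agree P s s'" "I k s'" "bounded l s'" for k s'
    using that
  proof (induction k arbitrary: s' rule: less_induct)
    case (less k)
    note c = bcost_bound[OF less.prems(3), of b]
    show ?case
    proof (cases "bval b s'")
      case True
      from step[OF less.prems(1,2) True less.prems(3)]
      obtain k' where k': "k = Suc k'" and "spec l s' P (I k')" by blast
      with less.prems(3) obtain t s1 where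
        1: "run P s' t s1" "t \<le> time_bound l P * (l + 1)" "bounded l s1" "I k' s1"
        unfolding spec_def by blast
      have "agree P s s1" using less.prems(1) run_agree[OF 1(1)] by (simp add: agree_def)
      from less.IH[OF _ this 1(4,3)] k' obtain u s2 where
        2: "run (While b P) s1 u s2"
          "u \<le> (k' * (bweight b + time_bound l P) + bweight b) * (l + 1)" "bounded l s2" "Q s2"
        by auto
      have "bcost b s' + t + u \<le> bweight b * (l + 1) + time_bound l P * (l + 1) +
          (k' * (bweight b + time_bound l P) + bweight b) * (l + 1)"
        using c 1(2) 2(2) by linarith
      also have "\<dots> = (k * (bweight b + time_bound l P) + bweight b) * (l + 1)"
        by (simp add: k' algebra_simps)
      finally show ?thesis using run.WhileTrue[OF True 1(1) 2(1)] 2 by blast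
    next
      case False
      have "bcost b s' \<le> (k * (bweight b + time_bound l P) + bweight b) * (l + 1)"
        using c by (simp add: algebra_simps)
      then show ?thesis
        using run.WhileFalse[OF False, of P] post[OF less.prems(1,2) False] less.prems(3) by blast
    qed
  qed
  have "(k * (bweight b + time_bound l P) + bweight b) * (l + 1)
     \<le> time_bound l (While b P) * (l + 1)"
    using I(2) by (intro mult_right_mono) (simp_all add: mult_right_mono)
  then show ?thesis
    unfolding spec_def using *[of s k] I(1) by (fastforce simp: agree_def intro: order_trans)
qed

text \<open>The counter is not initialised here: the loop starts at its current value and stops
  before the limit \<open>e\<close>.\<close>

definition For :: "name \<Rightarrow> aexp \<Rightarrow> com \<Rightarrow> com" where
  "For x e P = While (Less (Cell x (Const 0)) e)
     (Seq P (Assign x (Const 0) (Add (Cell x (Const 0)) (Const 1))))"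

lemma assigned_For [simp]: "assigned (For x e P) = insert x (assigned P)"
  by (simp add: For_def)

text \<open>The body has to establish the invariant for the store with the counter already advanced,
  so the closing increment is dealt with here once and for all.\<close>

lemma spec_For:
  assumes lim: "\<And>s'. agree (For x e P) s s' \<Longrightarrow> aval e s' = int b"
    and b: "b \<le> l" and ab: "s x 0 = int a" "a \<le> b" and I: "I a s"
    and step: "\<And>k s'. a \<le> k \<Longrightarrow> k < b \<Longrightarrow> agree (For x e P) s s' \<Longrightarrow> I k s' \<Longrightarrow>
      s' x 0 = int k \<Longrightarrow> bounded l s' \<Longrightarrow>
      spec l s' P (\<lambda>s2. s2 x 0 = int k \<and> I (Suc k) (s2(x := (s2 x)(0 := int (Suc k)))))"
    and post: "\<And>s'. agree (For x e P) s s' \<Longrightarrow> I b s' \<Longrightarrow> bounded l s' \<Longrightarrow> Q s'"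
  shows "spec l s (For x e P) Q"
proof -
  \<comment> \<open>The variant for \<open>spec_While\<close> is the distance \<open>b - k\<close>
    of the counter from the limit.\<close>
  define J where "J = (\<lambda>m s'. \<exists>k. a \<le> k \<and> k \<le> b \<and> m = b - k \<and> s' x 0 = int k \<and> I k s')"
  let ?P = "Seq P (Assign x (Const 0) (Add (Cell x (Const 0)) (Const 1)))"
  have ag: "agree (For x e P) s s' \<longleftrightarrow> agree ?P s s'" for s'
    by (auto simp: agree_def For_def)
  have "(b::nat) < 2 ^ b" by (rule less_exp)
  also have "(2::nat) ^ b \<le> 2 ^ l" using b by (intro power_increasing) auto
  finally have "int b < int (2 ^ l)" by (rule of_nat_less_iff[THEN iffD2])
  then have bl: "int b < 2 ^ l" by simp
  show ?thesis unfolding For_def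
  proof (rule spec_While[where I = J and k = "b - a"])
    show "J (b - a) s" using ab I by (auto simp: J_def)
    show "b - a \<le> l" using b by simp
  next
    fix m s' assume 1: "agree ?P s s'" "J m s'" "bval (Less (Cell x (Const 0)) e) s'" "bounded l s'"
    then obtain k where k: "a \<le> k" "k \<le> b" "m = b - k" "s' x 0 = int k" "I k s'"
      by (auto simp: J_def)
    have lt: "k < b" using 1(3) k lim[of s'] 1(1) by (simp add: ag)
    have "spec l s' ?P (J (b - Suc k))"
    proof (rule spec_Seq, rule spec_conseq)
      show "spec l s' P (\<lambda>s2. s2 x 0 = int k \<and> I (Suc k) (s2(x := (s2 x)(0 := int (Suc k)))))"
        using step[of k s'] k lt 1 by (simp add: ag)
    next
      fix s2
      assume 2: "s2 x 0 = int k \<and> I (Suc k) (s2(x := (s2 x)(0 := int (Suc k))))"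
      show "spec l s2 (Assign x (Const 0) (Add (Cell x (Const 0)) (Const 1))) (J (b - Suc k))"
      proof (rule spec_Assign)
        show "\<bar>aval (Add (Cell x (Const 0)) (Const 1)) s2\<bar> < 2 ^ l"
          using 2 lt \<open>int b < 2 ^ l\<close> by (simp del: of_nat_less_numeral_power_cancel_iff)
        show "J (b - Suc k) (s2(x := (s2 x)(aval (Const 0) s2 :=
            aval (Add (Cell x (Const 0)) (Const 1)) s2)))"
          using 2 k lt unfolding J_def by (intro exI[of _ "Suc k"]) (simp add: add.commute)
      qed
    qed
    then show "\<exists>m'. m = Suc m' \<and> spec l s' ?P (J m')"
      using k lt by (intro exI[of _ "b - Suc k"]) auto
  next
    fix m s' assume 1: "agree ?P s s'" "J m s'" "\<not> bval (Less (Cell x (Const 0)) e) s'" "bounded l s'"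
    then show "Q s'" using lim[of s'] post[of s'] by (auto simp: J_def ag)
  qed
qed

text \<open>For a fixed program only \<open>m\<close> varies: each loop multiplies by
  \<open>m\<close>, and everything else is a constant or a sum.\<close>

lemma time_bound_poly: "\<exists>p. \<forall>m. time_bound m P = poly p m"
proof (induction P)
  case Skip
  show ?case by (rule exI[of _ "[:1:]"]) simp
next
  case (Assign x a e)
  show ?case by (rule exI[of _ "[:aweight a + aweight e + 1:]"]) simp
next
  case (Seq P Q)
  then obtain p q where "\<forall>m. time_bound m P = poly p m" "\<forall>m. time_bound m Q = poly q m" by blast
  then show ?case by (intro exI[of _ "p + q"]) simp
next
  case (Cond b P Q)
  then obtain p q where "\<forall>m. time_bound m P = poly p m" "\<forall>m. time_bound m Q = poly q m" by blast
  then show ?case by (intro exI[of _ "[:bweight b:] + p + q"]) simp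
next
  case (While b P)
  then obtain p where "\<forall>m. time_bound m P = poly p m" by blast
  then show ?case by (intro exI[of _ "[:0, 1:] * ([:bweight b:] + p) + [:bweight b:]"]) simp
qed

section \<open>Dual fitting\<close>

text \<open>Jobs are the vertices of a graph. The diagonal pairs carry the terms
  \<open>w i * \<mu> i\<close>, so that both sums of the objective become one sum over
  edges.\<close>

definition edges :: "nat \<Rightarrow> (nat \<times> nat) set" where
  "edges n = {(i, j). 1 \<le> i \<and> i \<le> j \<and> j \<le> n}"

text \<open>This is the penalty in a prize-collecting vertex cover problem: every edge left
  uncovered by \<open>S\<close> pays \<open>A e\<close>.\<close>

definition free_cost :: "nat \<Rightarrow> (nat \<times> nat \<Rightarrow> 'a) \<Rightarrow> nat set \<Rightarrow> 'a::comm_monoid_add" where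
  "free_cost n A S = (\<Sum>e\<in>{e \<in> edges n. fst e \<notin> S \<and> snd e \<notin> S}. A e)"

text \<open>A diagonal pair counts once here, not twice.\<close>

definition load :: "nat \<Rightarrow> (nat \<times> nat \<Rightarrow> int) \<Rightarrow> nat \<Rightarrow> int" where
  "load n y i = (\<Sum>e\<in>edges n. if i = fst e \<or> i = snd e then y e else 0)"

text \<open>Feasible dual variables \<open>y\<close> with slacks \<open>r\<close> in which every processed edge is either
  saturated or has an end with slack zero. The multiplier of the budget is \<open>2 g / B\<close>, and the
  dual variables are scaled by \<open>B\<close>.\<close>

definition dual_state ::
  "nat \<Rightarrow> (nat \<times> nat \<Rightarrow> int) \<Rightarrow> (nat \<Rightarrow> int) \<Rightarrow> int \<Rightarrow> int \<Rightarrow> (nat \<times> nat) set \<Rightarrow> (nat \<Rightarrow> int) \<Rightarrow> bool"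
  where "dual_state n A K B g F r \<longleftrightarrow> (\<exists>y.
     (\<forall>e\<in>edges n. 0 \<le> y e \<and> y e \<le> B * A e) \<and>
     (\<forall>i\<in>{1..n}. r i = 2 * g * K i - load n y i \<and> 0 \<le> r i) \<and>
     (\<forall>e\<in>F. y e = B * A e \<or> r (fst e) = 0 \<or> r (snd e) = 0) \<and>
     (\<forall>e\<in>edges n - F. y e = 0))"

lemma finite_edges [simp]: "finite (edges n)"
  by (rule finite_subset[of _ "{1..n} \<times> {1..n}"]) (auto simp: edges_def)

lemma dual_state_init:
  assumes "\<And>e. e \<in> edges n \<Longrightarrow> 0 \<le> A e" "0 \<le> B" "0 \<le> g" "\<And>i. i \<in> {1..n} \<Longrightarrow> 0 \<le> K i"
    "\<And>i. i \<in> {1..n} \<Longrightarrow> r i = 2 * g * K i"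
  shows "dual_state n A K B g {} r"
  unfolding dual_state_def using assms by (intro exI[of _ "\<lambda>_. 0"]) (auto simp: load_def)

text \<open>The upper bound puts the jobs with \<open>K i = 0\<close> among those without slack,
  which settles the case of a zero budget.\<close>

lemma dual_state_bounds:
  assumes "dual_state n A K B g F r" "i \<in> {1..n}"
  shows "0 \<le> r i" "r i \<le> 2 * g * K i"
proof -
  obtain y where y: "\<forall>e\<in>edges n. 0 \<le> y e \<and> y e \<le> B * A e"
    "\<forall>i\<in>{1..n}. r i = 2 * g * K i - load n y i \<and> 0 \<le> r i"
    using assms unfolding dual_state_def by blast
  have "0 \<le> load n y i" unfolding load_def using y(1) by (intro sum_nonneg) auto
  then show "0 \<le> r i" "r i \<le> 2 * g * K i" using bspec[OF y(2) assms(2)] by auto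
qed

lemma load_update:
  assumes "e \<in> edges n" "y e = 0"
  shows "load n (y(e := d)) i = load n y i + (if i = fst e \<or> i = snd e then d else 0)"
proof -
  have "load n z i = (if i = fst e \<or> i = snd e then z e else 0)
      + (\<Sum>f\<in>edges n - {e}. if i = fst f \<or> i = snd f then z f else 0)" for z
    unfolding load_def using assms(1) by (simp add: sum.remove)
  from this[of "y(e := d)"] this[of y] assms(2) show ?thesis
    by (simp cong: if_cong sum.cong_simp)
qed

text \<open>The dual variable of \<open>(i, j)\<close> rises by the largest feasible amount:
  whichever term attains the minimum, either the pair becomes saturated or an end loses all its
  slack.\<close>

lemma dual_state_step:
  assumes d: "dual_state n A K B g F r" and e: "(i, j) \<in> edges n - F"
    and A: "0 \<le> B * A (i, j)"
    and r': "\<And>k. k \<in> {1..n} \<Longrightarrow>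
      r' k = r k - (if k = i \<or> k = j then min (B * A (i, j)) (min (r i) (r j)) else 0)"
    and F: "F \<subseteq> edges n"
  shows "dual_state n A K B g (insert (i, j) F) r'"
proof -
  define d where "d = min (B * A (i, j)) (min (r i) (r j))"
  obtain y where y: "\<forall>e\<in>edges n. 0 \<le> y e \<and> y e \<le> B * A e"
    "\<forall>i\<in>{1..n}. r i = 2 * g * K i - load n y i \<and> 0 \<le> r i"
    "\<forall>e\<in>F. y e = B * A e \<or> r (fst e) = 0 \<or> r (snd e) = 0" "\<forall>e\<in>edges n - F. y e = 0"
    using assms(1) unfolding dual_state_def by blast
  have ij: "i \<in> {1..n}" "j \<in> {1..n}" using e by (auto simp: edges_def)
  then have d0: "0 \<le> d" "d \<le> B * A (i, j)" "d \<le> r i" "d \<le> r j" 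
    using bspec[OF y(2) ij(1)] bspec[OF y(2) ij(2)] A by (auto simp: d_def)
  have z: "y (i, j) = 0" using y(4) e by auto
  \<comment> \<open>If an end has no slack, the increment is 0. So exhausted jobs stay exhausted,
    and the condition on \<open>F\<close> survives.\<close>
  have zero: "r' k = 0" if "k \<in> {1..n}" "r k = 0" for k
    using that r'[of k] ij A bspec[OF y(2) ij(1)] bspec[OF y(2) ij(2)]
    by (smt (verit, ccfv_threshold))
  show ?thesis
    unfolding dual_state_def
  proof (intro exI[of _ "y((i, j) := d)"] conjI ballI)
    fix e' assume "e' \<in> edges n"
    then show "0 \<le> (y((i, j) := d)) e'" "(y((i, j) := d)) e' \<le> B * A e'"
      using y(1) d0 by auto
  next
    fix k assume k: "k \<in> {1..n}"
    show "r' k = 2 * g * K k - load n (y((i, j) := d)) k"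
      using load_update[of "(i, j)" n y d k] z e r'[OF k] y(2) k by (auto simp: d_def)
    show "0 \<le> r' k" using r'[OF k] bspec[OF y(2) k] d0 unfolding d_def[symmetric] by auto
  next
    fix e' assume e': "e' \<in> insert (i, j) F"
    show "(y((i, j) := d)) e' = B * A e' \<or> r' (fst e') = 0 \<or> r' (snd e') = 0"
    proof (cases "e' = (i, j)")
      case True
      have "d = B * A (i, j) \<or> d = r i \<or> d = r j" unfolding d_def by (auto simp: min_def)
      then show ?thesis using True r'[OF ij(1)] r'[OF ij(2)] unfolding d_def[symmetric] by auto
    next
      case False
      then have "e' \<in> F" using e' by auto
      moreover have "fst e' \<in> {1..n}" "snd e' \<in> {1..n}" using \<open>e' \<in> F\<close> F by (auto simp: edges_def)
      ultimately show ?thesis using y(3) False zero by auto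
    qed
  next
    fix e' assume "e' \<in> edges n - insert (i, j) F"
    then show "(y((i, j) := d)) e' = 0" using y(4) by auto
  qed
qed

section \<open>Weak duality and the approximation guarantee\<close>

lemma sum_load:
  assumes "T \<subseteq> {1..n}"
  shows "(\<Sum>i\<in>T. load n y i) = (\<Sum>e\<in>edges n. y e * int (card ({fst e, snd e} \<inter> T)))"
proof -
  have "finite T" using assms finite_subset by blast
  have "(\<Sum>i\<in>T. load n y i) = (\<Sum>e\<in>edges n. \<Sum>i\<in>T. if i = fst e \<or> i = snd e then y e else 0)"
    unfolding load_def by (rule sum.swap)
  also have "\<dots> = (\<Sum>e\<in>edges n. y e * int (card ({fst e, snd e} \<inter> T)))"
  proof (rule sum.cong[OF refl])
    fix e :: "nat \<times> nat"
    have "(\<Sum>i\<in>T. if i = fst e \<or> i = snd e then y e else 0)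
       = (\<Sum>i\<in>{i\<in>T. i = fst e \<or> i = snd e}. y e)"
      by (rule sum.inter_filter[symmetric]) fact
    also have "{i\<in>T. i = fst e \<or> i = snd e} = {fst e, snd e} \<inter> T" by auto
    finally show "(\<Sum>i\<in>T. if i = fst e \<or> i = snd e then y e else 0)
       = y e * int (card ({fst e, snd e} \<inter> T))" by simp
  qed
  finally show ?thesis .
qed

text \<open>The sum of the dual variables lies between the two sides. For the left side, doubled:
  the jobs of \<open>S\<close> have used up \<open>2 * g * K i\<close>, each edge pays this to at
  most two ends, and edges not covered by \<open>S\<close> are saturated.\<close>

lemma dual_state_fitting:
  assumes d: "dual_state n A K B g (edges n) r"
    and A: "\<And>e. e \<in> edges n \<Longrightarrow> 0 \<le> A e" and B: "0 \<le> B" and g: "0 \<le> g"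
    and T: "T \<subseteq> {1..n}" "(\<Sum>i\<in>T. K i) \<le> B"
    and S: "S = {i\<in>{1..n}. r i = 0}"
  shows "B * free_cost n A S + g * (\<Sum>i\<in>S. K i) \<le> B * free_cost n A T + 2 * g * B"
proof -
  obtain y where y: "\<forall>e\<in>edges n. 0 \<le> y e \<and> y e \<le> B * A e"
    "\<forall>i\<in>{1..n}. r i = 2 * g * K i - load n y i \<and> 0 \<le> r i"
    "\<forall>e\<in>edges n. y e = B * A e \<or> r (fst e) = 0 \<or> r (snd e) = 0"
    using d unfolding dual_state_def by blast
  have free: "B * free_cost n A X = (\<Sum>e\<in>edges n. if fst e \<notin> X \<and> snd e \<notin> X then B * A e else 0)" for X
    unfolding free_cost_def by (simp add: sum_distrib_left sum.inter_filter if_distrib cong: if_cong)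
  have "2 * g * (\<Sum>i\<in>S. K i) = (\<Sum>i\<in>S. load n y i)"
    unfolding sum_distrib_left using y(2) S by (intro sum.cong) auto
  also have "\<dots> = (\<Sum>e\<in>edges n. y e * int (card ({fst e, snd e} \<inter> S)))"
    by (rule sum_load) (use S in auto)
  finally have "2 * (B * free_cost n A S) + 2 * g * (\<Sum>i\<in>S. K i) =
      (\<Sum>e\<in>edges n. (if fst e \<notin> S \<and> snd e \<notin> S then 2 * (B * A e) else 0)
         + y e * int (card ({fst e, snd e} \<inter> S)))"
    unfolding free by (simp add: sum.distrib sum_distrib_left if_distrib[of "\<lambda>x. 2 * x"] cong: if_cong)
  also have "\<dots> \<le> (\<Sum>e\<in>edges n. 2 * y e)"
  proof (rule sum_mono)
    fix e assume e: "e \<in> edges n"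
    show "(if fst e \<notin> S \<and> snd e \<notin> S then 2 * (B * A e) else 0)
         + y e * int (card ({fst e, snd e} \<inter> S)) \<le> 2 * y e"
    proof (cases "fst e \<notin> S \<and> snd e \<notin> S")
      case True
      have "fst e \<in> {1..n}" "snd e \<in> {1..n}" using e by (auto simp: edges_def)
      then have "y e = B * A e" using True y(3) e S by auto
      then show ?thesis using True by simp
    next
      case False
      have "card ({fst e, snd e} \<inter> S) \<le> card {fst e, snd e}" by (intro card_mono) auto
      also have "\<dots> \<le> 2" by (simp add: card_insert_if)
      finally have "y e * int (card ({fst e, snd e} \<inter> S)) \<le> y e * 2"
        using y(1) e by (intro mult_left_mono) auto
      then show ?thesis using False by auto
    qed
  qed
  finally have 1: "B * free_cost n A S + g * (\<Sum>i\<in>S. K i) \<le> (\<Sum>e\<in>edges n. y e)"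
    by (simp add: sum_distrib_left[symmetric])
  \<comment> \<open>Weak duality: \<open>y e\<close> is paid by the cost of the edge if
    \<open>T\<close> does not cover it, and otherwise by an end in \<open>T\<close>.\<close>
  have "(\<Sum>e\<in>edges n. y e) \<le> (\<Sum>e\<in>edges n. (if fst e \<notin> T \<and> snd e \<notin> T then B * A e else 0)
         + y e * int (card ({fst e, snd e} \<inter> T)))"
  proof (rule sum_mono)
    fix e assume e: "e \<in> edges n"
    show "y e \<le> (if fst e \<notin> T \<and> snd e \<notin> T then B * A e else 0)
         + y e * int (card ({fst e, snd e} \<inter> T))"
    proof (cases "fst e \<notin> T \<and> snd e \<notin> T")
      case True
      then show ?thesis using y(1) e by simp
    next
      case False
      then have "0 < card ({fst e, snd e} \<inter> T)" by (auto simp: card_gt_0_iff)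
      then have "1 \<le> int (card ({fst e, snd e} \<inter> T))" by linarith
      then have "y e * 1 \<le> y e * int (card ({fst e, snd e} \<inter> T))"
        using y(1) e by (intro mult_left_mono) auto
      then show ?thesis using False by auto
    qed
  qed
  also have "\<dots> = B * free_cost n A T + (\<Sum>i\<in>T. load n y i)"
    unfolding free sum_load[OF T(1)] by (simp add: sum.distrib)
  also have "(\<Sum>i\<in>T. load n y i) \<le> (\<Sum>i\<in>T. 2 * g * K i)"
    using y(2) T(1) by (intro sum_mono) force
  also have "\<dots> = 2 * g * (\<Sum>i\<in>T. K i)" by (simp add: sum_distrib_left)
  also have "\<dots> \<le> 2 * g * B" using T(2) g by (intro mult_left_mono) auto
  finally show ?thesis using 1 by linarith
qed

lemma free_cost_nonneg: "(\<And>e. e \<in> edges n \<Longrightarrow> 0 \<le> A e) \<Longrightarrow> 0 \<le> (free_cost n A S :: int)"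
  unfolding free_cost_def by (intro sum_nonneg) auto

text \<open>In the fitting inequality the cost of the selected set is dropped and \<open>g\<close>
  cancelled. Read backwards, a selection exceeding \<open>3 * B\<close> certifies
  \<open>g < free_cost n A T\<close> for every affordable \<open>T\<close>.\<close>

lemma dual_budget:
  assumes d: "dual_state n A K B g (edges n) r"
    and A: "\<And>e. e \<in> edges n \<Longrightarrow> 0 \<le> A e" and B: "0 \<le> B" and g: "0 < g"
    and T: "T \<subseteq> {1..n}" "(\<Sum>i\<in>T. K i) \<le> B" "free_cost n A T \<le> g"
  shows "(\<Sum>i\<in>{i\<in>{1..n}. r i = 0}. K i) \<le> 3 * B"
proof -
  let ?S = "{i\<in>{1..n}. r i = 0}"
  have "g * (\<Sum>i\<in>?S. K i) \<le> B * free_cost n A ?S + g * (\<Sum>i\<in>?S. K i)"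
    using B free_cost_nonneg[OF A] by simp
  also have "\<dots> \<le> B * free_cost n A T + 2 * g * B"
    using dual_state_fitting[OF d A B _ T(1,2) refl] g by simp
  also have "\<dots> \<le> B * g + 2 * g * B" using T(3) B by (simp add: mult_left_mono)
  finally have "g * (\<Sum>i\<in>?S. K i) \<le> g * (3 * B)" by (simp add: algebra_simps)
  then show ?thesis using g by simp
qed

text \<open>Costs divisible by 3 take care of \<open>g = 1\<close>, where the optimum may be \<open>0\<close>: the cost is then
  at most \<open>2\<close>, hence \<open>0\<close>.\<close>

lemma dual_approx:
  assumes d: "dual_state n A K B g (edges n) r"
    and A: "\<And>e. e \<in> edges n \<Longrightarrow> 0 \<le> A e \<and> 3 dvd A e" and B: "0 \<le> B" and g: "0 < g"
    and K: "\<And>i. i \<in> {1..n} \<Longrightarrow> 0 \<le> K i"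
    and S: "S = {i\<in>{1..n}. r i = 0}"
    and prev: "g = 1 \<or> (\<exists>r'. dual_state n A K B (g - 1) (edges n) r' \<and>
      3 * B < (\<Sum>i\<in>{i\<in>{1..n}. r' i = 0}. K i))"
    and T: "T \<subseteq> {1..n}" "(\<Sum>i\<in>T. K i) \<le> B"
  shows "free_cost n A S \<le> 3 * free_cost n A T"
proof -
  have A0: "\<And>e. e \<in> edges n \<Longrightarrow> 0 \<le> A e" using A by blast
  have fT: "0 \<le> free_cost n A T" by (rule free_cost_nonneg[OF A0])
  have finT: "finite T" using T(1) finite_subset by blast
  have KS: "0 \<le> g * (\<Sum>i\<in>S. K i)"
    using g K S by (intro mult_nonneg_nonneg sum_nonneg) auto
  note fit = dual_state_fitting[OF d A0 B _ T S]
  show ?thesis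
  proof (cases "B = 0")
    case True
    \<comment> \<open>For \<open>B = 0\<close> the fitting inequality says nothing about costs. But
      the jobs of an affordable \<open>T\<close> have \<open>K i = 0\<close>, hence no slack, so
      \<open>S\<close> covers every edge that \<open>T\<close> covers.\<close>
    have "T \<subseteq> S"
    proof
      fix i assume i: "i \<in> T"
      have "K i \<le> (\<Sum>i\<in>T. K i)" using i finT K T(1) by (intro member_le_sum) auto
      then have "K i = 0" using True T(2) K[of i] i T(1) by force
      then show "i \<in> S" using dual_state_bounds[OF d, of i] i T(1) S by auto
    qed
    then have "free_cost n A S \<le> free_cost n A T"
      unfolding free_cost_def using A0 by (intro sum_mono2) auto
    then show ?thesis using fT by linarith
  next
    case False
    then have B: "0 < B" using B by simp
    show ?thesis
    proof (cases "g \<le> free_cost n A T")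
      case True
      then have "2 * g * B \<le> 2 * free_cost n A T * B" using B by simp
      then have "B * free_cost n A S \<le> B * (3 * free_cost n A T)"
        using fit KS g by (simp add: algebra_simps)
      then show ?thesis using B by simp
    next
      case lt: False
      show ?thesis
      proof (cases "g = 1")
        case True
        then have 0: "free_cost n A T = 0" using lt fT by simp
        then have "B * free_cost n A S \<le> B * 2" using fit KS True by simp
        then have "free_cost n A S \<le> 2" using B by simp
        moreover have "3 dvd free_cost n A S"
          unfolding free_cost_def using A by (intro dvd_sum) auto
        moreover have "0 \<le> free_cost n A S" by (rule free_cost_nonneg[OF A0])
        ultimately have "free_cost n A S = 0" by presburger
        then show ?thesis using 0 by simp
      next
        case False
        then obtain r' where r': "dual_state n A K B (g - 1) (edges n) r'"
          "3 * B < (\<Sum>i\<in>{i\<in>{1..n}. r' i = 0}. K i)" using prev by blast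
        \<comment> \<open>Costs are integers, so \<open>free_cost n A T \<le> g - 1\<close>, and
          \<open>dual_budget\<close> applies to the preceding multiplier.\<close>
        have "(\<Sum>i\<in>{i\<in>{1..n}. r' i = 0}. K i) \<le> 3 * B"
          using dual_budget[OF r'(1) A0 _ _ T] B False g lt by simp
        then show ?thesis using r'(2) by simp
      qed
    qed
  qed
qed

section \<open>The encoded instance\<close>

text \<open>All rationals of the input in one sequence: the budget, then weight, mean and cost of
  job 1, of job 2, and so on. Entry \<open>k\<close> occupies the cells \<open>2 * k + 1\<close> and
  \<open>2 * k + 2\<close>, so a single loop can read them all.\<close>

definition entry ::
  "(nat \<Rightarrow> rat) \<Rightarrow> (nat \<Rightarrow> rat) \<Rightarrow> (nat \<Rightarrow> rat) \<Rightarrow> rat \<Rightarrow> nat \<Rightarrow> rat" where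
  "entry w \<mu> c C k = (if k = 0 then C else
     ([w, \<mu>, c] ! ((k - 1) mod 3)) ((k - 1) div 3 + 1))"

lemma encode_instance_entry:
  "encode_instance n w \<mu> c C =
     int n # concat (map (\<lambda>k. encode_rat (entry w \<mu> c C k)) [0..<3 * n + 1])"
proof -
  have "concat (map (\<lambda>k. encode_rat (entry w \<mu> c C k)) [0..<3 * n + 1]) = encode_rat C @
     concat (map (\<lambda>i. encode_rat (w i) @ encode_rat (\<mu> i) @ encode_rat (c i)) [1..<Suc n])"
  proof (induction n)
    case 0
    show ?case by (simp add: entry_def)
  next
    case (Suc n)
    have e: "entry w \<mu> c C (Suc (3 * n)) = w (Suc n)"
      "entry w \<mu> c C (Suc (Suc (3 * n))) = \<mu> (Suc n)"
      "entry w \<mu> c C (Suc (Suc (Suc (3 * n)))) = c (Suc n)"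
      by (simp_all add: entry_def mod_Suc div_Suc)
    have "[0..<3 * Suc n + 1] = [0..<3 * n + 1] @
        [Suc (3 * n), Suc (Suc (3 * n)), Suc (Suc (Suc (3 * n)))]"
      by (simp add: numeral_eq_Suc)
    then have "concat (map (\<lambda>k. encode_rat (entry w \<mu> c C k)) [0..<3 * Suc n + 1]) =
        concat (map (\<lambda>k. encode_rat (entry w \<mu> c C k)) [0..<3 * n + 1]) @
        encode_rat (w (Suc n)) @ encode_rat (\<mu> (Suc n)) @ encode_rat (c (Suc n))"
      by (simp del: upt_Suc add: e)
    also have "[1..<Suc (Suc n)] = [1..<Suc n] @ [Suc n]" by simp
    ultimately show ?case using Suc by (simp del: upt_Suc)
  qed
  then show ?thesis by (simp add: encode_instance_def)
qed

lemma length_concat_pairs: "length (concat (map (\<lambda>k. [a k, b k]) [0..<m])) = 2 * m"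
  by (induction m) auto

lemma nth_concat_pairs:
  assumes "k < m"
  shows "concat (map (\<lambda>k. [a k, b k]) [0..<m]) ! (2 * k) = a k"
    and "concat (map (\<lambda>k. [a k, b k]) [0..<m]) ! (2 * k + 1) = b k"
  using assms by (induction m) (auto simp: nth_append length_concat_pairs less_Suc_eq)

locale outlier_instance =
  fixes n :: nat and w \<mu> c :: "nat \<Rightarrow> rat" and C :: rat
  assumes job_nonneg: "\<And>i. i \<in> {1..n} \<Longrightarrow> w i > 0 \<and> \<mu> i \<ge> 0 \<and> c i \<ge> 0"
    and budget_nonneg: "C \<ge> 0"
begin

section \<open>Numbers of the input and their lengths\<close>

definition num :: "nat \<Rightarrow> int" where "num k = fst (quotient_of (entry w \<mu> c C k))"
definition den :: "nat \<Rightarrow> int" where "den k = snd (quotient_of (entry w \<mu> c C k))"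

definition input :: "int list" where "input = encode_instance n w \<mu> c C"
definition N :: nat where "N = input_size input"
text \<open>\<open>U\<close> is the yardstick for magnitudes: numbers below a constant times a fixed
  power of \<open>U\<close> have length linear in \<open>N\<close>.\<close>

definition U :: int where "U = 2 ^ N"

lemma input_eq: "input = int n # concat (map (\<lambda>k. [num k, den k]) [0..<3 * n + 1])"
  by (simp add: input_def encode_instance_entry encode_rat_def num_def den_def)

lemma input_cells:
  "initial_store input ''in'' 0 = int n"
  "k \<le> 3 * n \<Longrightarrow> initial_store input ''in'' (2 * int k + 1) = num k"
  "k \<le> 3 * n \<Longrightarrow> initial_store input ''in'' (2 * int k + 2) = den k"
proof -
  have l: "length input = 6 * n + 3"
    by (simp del: upt_Suc add: input_eq length_concat_pairs)
  show "initial_store input ''in'' 0 = int n"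
    by (simp add: initial_store_def l) (simp add: input_eq)
  assume k: "k \<le> 3 * n"
  have i: "nat (2 * int k + 1) = Suc (2 * k)" "nat (2 * int k + 2) = Suc (2 * k + 1)" by auto
  show "initial_store input ''in'' (2 * int k + 1) = num k"
    using k unfolding initial_store_def l i
    by (simp del: upt_Suc add: input_eq nth_concat_pairs(1))
  have "input ! Suc (2 * k + 1) = den k"
    using k nth_concat_pairs(2)[of k "3 * n + 1" num den] by (simp del: upt_Suc add: input_eq)
  then show "initial_store input ''in'' (2 * int k + 2) = den k"
    using k unfolding initial_store_def l i by simp
qed

lemma N_eq: "N = bit_size (int n) + (\<Sum>k<3 * n + 1. bit_size (num k) + bit_size (den k))"
proof -
  have "(\<Sum>x\<leftarrow>concat (map (\<lambda>k. [num k, den k]) [0..<m]). bit_size x) =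
      (\<Sum>k<m. bit_size (num k) + bit_size (den k))" for m
    by (induction m) auto
  then show ?thesis by (simp del: upt_Suc add: N_def input_size_def input_eq)
qed

text \<open>Every number of the input has at least its sign bit. As \<open>n\<close> itself is given
  in binary, this is what makes loops over the jobs short.\<close>

lemma N_ge: "3 * n + 1 \<le> N"
proof -
  have "(\<Sum>k<3 * n + 1. 1) \<le> (\<Sum>k<3 * n + 1. bit_size (num k) + bit_size (den k))"
    by (intro sum_mono) (simp add: bit_size_def)
  then show ?thesis by (simp add: N_eq)
qed

lemma U_ge: "1 \<le> U" "3 * int n + 1 \<le> U"
proof -
  show "1 \<le> U" by (simp add: U_def)
  have "int N < int (2 ^ N)" by (rule of_nat_less_iff[THEN iffD2]) (rule less_exp)
  then have "int N < U" by (simp add: U_def)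
  then show "3 * int n + 1 \<le> U" using N_ge by linarith
qed

lemma bounded_initial: "bounded N (initial_store input)"
proof -
  have "\<bar>v\<bar> < 2 ^ N" if "v \<in> set input" for v
  proof -
    have "bit_size v \<le> N"
      unfolding N_def input_size_def using that by (intro member_le_sum_list) auto
    then have "(2::int) ^ bit_size v \<le> 2 ^ N" by (intro power_increasing) auto
    then show ?thesis using less_bit_size[of v] by linarith
  qed
  then show ?thesis
    by (auto simp: bounded_def initial_store_def)
qed

lemma entry_nonneg: "k \<le> 3 * n \<Longrightarrow> 0 \<le> entry w \<mu> c C k"
proof -
  assume k: "k \<le> 3 * n"
  show ?thesis
  proof (cases "k = 0")
    case True
    then show ?thesis using budget_nonneg by (simp add: entry_def)
  next
    case False
    let ?i = "(k - 1) div 3 + 1"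
    have "?i \<in> {1..n}" using k False by auto
    note j = job_nonneg[OF this]
    have "(k - 1) mod 3 < 3" by simp
    then consider "(k - 1) mod 3 = 0" | "(k - 1) mod 3 = 1" | "(k - 1) mod 3 = 2" by linarith
    then show ?thesis using False j by cases (auto simp: entry_def)
  qed
qed

lemma den_pos: "0 < den k"
  unfolding den_def by (metis quotient_of_denom_pos')

lemma entry_eq: "entry w \<mu> c C k = of_int (num k) / of_int (den k)"
  unfolding den_def num_def by (metis quotient_of_div surjective_pairing)

lemma num_nonneg: "k \<le> 3 * n \<Longrightarrow> 0 \<le> num k"
  using entry_nonneg[of k] den_pos[of k] by (auto simp: entry_eq zero_le_divide_iff)

lemma num_le: "k \<le> 3 * n \<Longrightarrow> num k \<le> U"
proof -
  assume k: "k \<le> 3 * n"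
  have "\<bar>num k\<bar> < U" using bounded_initial input_cells(2)[OF k]
    unfolding bounded_def U_def by metis
  then show ?thesis by linarith
qed

section \<open>Clearing denominators\<close>

definition D :: int where "D = (\<Prod>k<3 * n + 1. den k)"

text \<open>The lengths of the denominators add up to at most \<open>N\<close>. Partial products are
  covered because the program stores them on the way to \<open>D\<close>.\<close>

lemma prod_den: "m \<le> 3 * n + 1 \<Longrightarrow> 1 \<le> (\<Prod>k<m. den k) \<and> (\<Prod>k<m. den k) \<le> U"
proof
  assume m: "m \<le> 3 * n + 1"
  have "(\<Prod>k<m. 1) \<le> (\<Prod>k<m. den k)" using den_pos by (intro prod_mono) (auto intro: int_one_le_iff_zero_less[THEN iffD2])
  then show "1 \<le> (\<Prod>k<m. den k)" by simp
  have "(\<Prod>k<m. den k) \<le> (\<Prod>k<m. 2 ^ bit_size (den k))"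
    using den_pos less_bit_size by (intro prod_mono) (smt (verit))
  also have "\<dots> = 2 ^ (\<Sum>k<m. bit_size (den k))" by (simp add: power_sum)
  also have "\<dots> \<le> U" unfolding U_def
  proof (rule power_increasing)
    have "(\<Sum>k<m. bit_size (den k)) \<le> (\<Sum>k<3 * n + 1. bit_size (den k))"
      using m by (intro sum_mono2) auto
    then show "(\<Sum>k<m. bit_size (den k)) \<le> N" by (simp add: N_eq sum.distrib)
  qed simp
  finally show "(\<Prod>k<m. den k) \<le> U" .
qed

lemma D_bounds: "1 \<le> D" "D \<le> U"
  using prod_den[of "3 * n + 1"] by (simp_all add: D_def)

text \<open>For the entries of the input \<open>den k\<close> divides \<open>D\<close>, so the
  division is exact.\<close>

definition scaled :: "nat \<Rightarrow> int" where "scaled k = num k * D div den k"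

lemma scaled_eq: "k \<le> 3 * n \<Longrightarrow> of_int (scaled k) = entry w \<mu> c C k * of_int D"
proof -
  assume "k \<le> 3 * n"
  then have "den k dvd D" unfolding D_def by (intro dvd_prodI) auto
  then obtain e where "D = den k * e" by (elim dvdE)
  then show ?thesis using den_pos[of k] by (simp add: scaled_def entry_eq)
qed

lemma scaled_bounds: "k \<le> 3 * n \<Longrightarrow> 0 \<le> scaled k" "k \<le> 3 * n \<Longrightarrow> scaled k \<le> num k * D"
  "k \<le> 3 * n \<Longrightarrow> scaled k \<le> U\<^sup>2"
proof -
  assume k: "k \<le> 3 * n"
  have 0: "0 \<le> num k * D" using num_nonneg[OF k] D_bounds by simp
  then show "0 \<le> scaled k" using den_pos[of k] by (simp add: scaled_def pos_imp_zdiv_nonneg_iff)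
  show 1: "scaled k \<le> num k * D" unfolding scaled_def
    using abs_div_le[of "num k * D" "den k"] 0 by linarith
  have "num k * D \<le> U * U"
    using num_nonneg[OF k] num_le[OF k] D_bounds by (intro mult_mono) auto
  then show "scaled k \<le> U\<^sup>2" using 1 by (simp add: power2_eq_square)
qed

definition W :: "nat \<Rightarrow> int" where "W i = scaled (3 * i - 2)"
definition M :: "nat \<Rightarrow> int" where "M i = scaled (3 * i - 1)"
definition K :: "nat \<Rightarrow> int" where "K i = scaled (3 * i)"
definition B :: int where "B = scaled 0"

text \<open>The factor 3 is the divisibility required by \<open>dual_approx\<close>.\<close>

definition A :: "nat \<times> nat \<Rightarrow> int" where
  "A = (\<lambda>(i, j). 3 * min (W j * M i) (W i * M j))"

lemma entries:
  assumes "i \<in> {1..n}"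
  shows "entry w \<mu> c C (3 * i - 2) = w i" "entry w \<mu> c C (3 * i - 1) = \<mu> i"
    "entry w \<mu> c C (3 * i) = c i"
proof -
  obtain j where j: "i = Suc j" using assms by (cases i) auto
  then have e: "3 * i - 2 = Suc (3 * j)" "3 * i - 1 = Suc (Suc (3 * j))"
    "3 * i = Suc (Suc (Suc (3 * j)))" by simp_all
  show "entry w \<mu> c C (3 * i - 2) = w i" "entry w \<mu> c C (3 * i - 1) = \<mu> i"
    "entry w \<mu> c C (3 * i) = c i"
    unfolding e by (simp_all add: entry_def mod_Suc div_Suc j)
qed

lemma scaled_jobs:
  assumes "i \<in> {1..n}"
  shows "of_int (W i) = w i * of_int D" "of_int (M i) = \<mu> i * of_int D"
    "of_int (K i) = c i * of_int D"
  unfolding W_def M_def K_def entries[OF assms, symmetric]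
  using assms by (auto intro!: scaled_eq)

lemma scaled_budget: "of_int B = C * of_int D"
  using scaled_eq[of 0] by (simp add: B_def entry_def)

lemma job_bounds:
  assumes "i \<in> {1..n}"
  shows "0 \<le> W i" "0 \<le> M i" "0 \<le> K i" "W i \<le> U\<^sup>2" "M i \<le> U\<^sup>2" "K i \<le> U\<^sup>2"
  using assms unfolding W_def M_def K_def by (auto intro!: scaled_bounds)

lemma B_bounds: "0 \<le> B" "B \<le> U\<^sup>2"
  unfolding B_def by (auto intro!: scaled_bounds)

lemma edge_jobs: "e \<in> edges n \<Longrightarrow> fst e \<in> {1..n} \<and> snd e \<in> {1..n}"
  by (auto simp: edges_def)

lemma A_nonneg: "e \<in> edges n \<Longrightarrow> 0 \<le> A e" and A_dvd: "3 dvd A e"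
  using job_bounds[of "fst e"] job_bounds[of "snd e"] edge_jobs[of e]
  by (auto simp: A_def split: prod.splits)

text \<open>\<open>Z D\<close> bounds the sums of the \<open>W i\<close> and of the \<open>M i\<close>, hence \<open>H - 2\<close> bounds every cost.\<close>

definition Z :: int where "Z = (\<Sum>k<3 * n + 1. num k)"
definition H :: int where "H = 3 * (Z * Z * (D * D)) + 2"

lemma sum_num_le: "m \<le> 3 * n + 1 \<Longrightarrow> 0 \<le> (\<Sum>k<m. num k) \<and> (\<Sum>k<m. num k) \<le> U\<^sup>2"
proof
  assume m: "m \<le> 3 * n + 1"
  show "0 \<le> (\<Sum>k<m. num k)" using m num_nonneg by (intro sum_nonneg) auto
  have "(\<Sum>k<m. num k) \<le> (\<Sum>k<m. U)" using m num_le by (intro sum_mono) auto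
  also have "\<dots> = int m * U" by simp
  also have "\<dots> \<le> U * U" using m U_ge by (intro mult_right_mono) auto
  finally show "(\<Sum>k<m. num k) \<le> U\<^sup>2" by (simp add: power2_eq_square)
qed

lemma H_bounds: "2 \<le> H" "H \<le> 5 * U ^ 6"
proof -
  have Z: "0 \<le> Z" "Z \<le> U\<^sup>2" using sum_num_le[of "3 * n + 1"] by (simp_all add: Z_def)
  show "2 \<le> H" using Z D_bounds by (simp add: H_def)
  have "Z * Z * (D * D) \<le> U\<^sup>2 * U\<^sup>2 * (U * U)"
    using Z D_bounds U_ge by (intro mult_mono) auto
  also have "\<dots> = U ^ 6" 
    by (simp only: power2_eq_square[symmetric] power_add[symmetric]) simp
  finally have "Z * Z * (D * D) \<le> U ^ 6" .
  moreover have "1 \<le> U ^ 6" using U_ge by (simp add: one_le_power)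
  ultimately show "H \<le> 5 * U ^ 6" by (simp add: H_def)
qed

text \<open>The minimum is at most \<open>W i * M j\<close>, and summing over all pairs, not only
  \<open>i \<le> j\<close>, gives a product of two sums. Each is at most \<open>Z * D\<close>
  because different jobs use different entries.\<close>

lemma free_cost_empty_le: "free_cost n A {} \<le> H - 2"
proof -
  have inj1: "inj_on (\<lambda>i. 3 * i - 2) {1..n}" and inj2: "inj_on (\<lambda>i. 3 * i - 1) {1..n}"
    by (auto simp: inj_on_def)
  have sub: "(\<Sum>i=1..n. scaled (f i)) \<le> Z * D" if f: "inj_on f {1..n}" "f ` {1..n} \<subseteq> {..3 * n}" for f
  proof -
    have "(\<Sum>i=1..n. scaled (f i)) = (\<Sum>k\<in>f ` {1..n}. scaled k)"
      using f(1) by (simp add: sum.reindex)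
    also have "\<dots> \<le> (\<Sum>k\<in>{..3 * n}. scaled k)"
      using f(2) by (intro sum_mono2) (auto intro: scaled_bounds)
    also have "\<dots> \<le> (\<Sum>k\<in>{..3 * n}. num k * D)"
      by (intro sum_mono) (auto intro: scaled_bounds)
    also have "\<dots> = Z * D" by (simp add: Z_def sum_distrib_right lessThan_Suc_atMost)
    finally show ?thesis .
  qed
  have W: "(\<Sum>i=1..n. W i) \<le> Z * D"
    unfolding W_def by (rule sub[OF inj1]) auto
  have M: "(\<Sum>i=1..n. M i) \<le> Z * D"
    unfolding M_def by (rule sub[OF inj2]) auto
  have "free_cost n A {} = (\<Sum>e\<in>edges n. A e)" by (simp add: free_cost_def)
  also have "\<dots> \<le> (\<Sum>e\<in>edges n. 3 * (W (fst e) * M (snd e)))"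
    by (intro sum_mono) (auto simp: A_def split: prod.splits)
  also have "\<dots> \<le> (\<Sum>e\<in>{1..n} \<times> {1..n}. 3 * (W (fst e) * M (snd e)))"
    using job_bounds by (intro sum_mono2) (auto simp: edges_def)
  also have "\<dots> = 3 * ((\<Sum>i=1..n. W i) * (\<Sum>i=1..n. M i))"
    unfolding sum_distrib_left[of 3, symmetric] sum_product sum.cartesian_product split_def ..
  also have "\<dots> \<le> 3 * ((Z * D) * (Z * D))"
    using W M job_bounds by (intro mult_left_mono mult_mono)
      (auto intro!: sum_nonneg intro: order_trans[OF sum_nonneg W])
  finally show ?thesis by (simp add: H_def algebra_simps)
qed

text \<open>One factor \<open>D\<close> comes from the weights, one from the means, and 3 from
  \<open>A\<close>. For \<open>i = j\<close> the minimum is \<open>w i * \<mu> i\<close>, so the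
  second sum of \<open>completion_cost\<close> is the diagonal.\<close>

lemma completion_cost_edges:
  assumes "S \<subseteq> {1..n}"
  shows "of_int (free_cost n A S) = 3 * (of_int D)\<^sup>2 * completion_cost n w \<mu> S"
proof -
  let ?f = "\<lambda>i j. min (w j * \<mu> i) (w i * \<mu> j)"
  let ?R = "{1..n} - S"
  have "completion_cost n w \<mu> S = (\<Sum>i\<in>?R. \<Sum>j\<in>{j\<in>?R. i \<le> j}. ?f i j)"
    unfolding completion_cost_def sum.distrib[symmetric]
  proof (rule sum.cong[OF refl])
    fix i assume "i \<in> ?R"
    then have "{j \<in> ?R. i \<le> j} = insert i {j \<in> ?R. j > i}" by auto
    then show "(\<Sum>j\<in>{j \<in> ?R. j > i}. ?f i j) + w i * \<mu> i = (\<Sum>j\<in>{j\<in>?R. i \<le> j}. ?f i j)"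
      by simp
  qed
  also have "\<dots> = (\<Sum>e\<in>(SIGMA i:?R. {j\<in>?R. i \<le> j}). ?f (fst e) (snd e))"
    by (simp add: sum.Sigma split_def)
  also have "(SIGMA i:?R. {j\<in>?R. i \<le> j}) = {e \<in> edges n. fst e \<notin> S \<and> snd e \<notin> S}"
    by (auto simp: edges_def)
  finally have cc: "completion_cost n w \<mu> S =
      (\<Sum>e\<in>{e \<in> edges n. fst e \<notin> S \<and> snd e \<notin> S}. ?f (fst e) (snd e))" .
  have "of_int (A e) = 3 * (of_int D)\<^sup>2 * ?f (fst e) (snd e)" if "e \<in> edges n" for e
  proof -
    have D: "of_int D * of_int D > (0::rat)" using D_bounds by simp
    have "of_int (A e) = 3 * min (of_int (W (snd e)) * of_int (M (fst e)))
        (of_int (W (fst e)) * (of_int (M (snd e)) :: rat))"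
      by (simp add: A_def split_def of_int_min)
    also have "\<dots> = 3 * min (of_int D * of_int D * (w (snd e) * \<mu> (fst e)))
        (of_int D * of_int D * (w (fst e) * \<mu> (snd e)))"
      using edge_jobs[OF that] by (simp add: scaled_jobs mult_ac)
    also have "\<dots> = 3 * (of_int D * of_int D * ?f (fst e) (snd e))"
      using less_imp_le[OF D]
      unfolding min_mult_distrib_left[of "of_int D * of_int D" "w (snd e) * \<mu> (fst e)"]
      by (simp only: if_True)
    finally show ?thesis by (simp add: power2_eq_square mult_ac)
  qed
  then show ?thesis unfolding cc free_cost_def of_int_sum sum_distrib_left
    by (intro sum.cong) auto
qed

lemma sum_K: "S \<subseteq> {1..n} \<Longrightarrow> of_int (\<Sum>i\<in>S. K i) = of_int D * (\<Sum>i\<in>S. c i)"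
  unfolding of_int_sum sum_distrib_left using scaled_jobs
  by (intro sum.cong) (auto simp: mult.commute)

text \<open>Dividing by \<open>D\<close> and by three times its square undoes the scaling.
  \<open>G_star\<close> is attained at some \<open>T\<close>, to which \<open>opt\<close> is
  applied.\<close>

lemma approx_from_dual:
  assumes S: "S \<subseteq> {1..n}" "(\<Sum>i\<in>S. K i) \<le> 3 * B"
    and opt: "\<And>T. T \<subseteq> {1..n} \<Longrightarrow> (\<Sum>i\<in>T. K i) \<le> B \<Longrightarrow> free_cost n A S \<le> 3 * free_cost n A T"
  shows "(\<Sum>i\<in>S. c i) \<le> 3 * C" "completion_cost n w \<mu> S \<le> 3 * G_star n w \<mu> c C"
proof -
  have D: "(of_int D :: rat) > 0" using D_bounds by simp
  have "of_int (\<Sum>i\<in>S. K i) \<le> (of_int (3 * B) :: rat)" using S(2) by (simp only: of_int_le_iff)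
  then have "of_int D * (\<Sum>i\<in>S. c i) \<le> of_int D * (3 * C)"
    unfolding sum_K[OF S(1)] by (simp add: scaled_budget mult_ac)
  then show "(\<Sum>i\<in>S. c i) \<le> 3 * C" using D by (simp only: mult_le_cancel_left_pos)
  let ?X = "{completion_cost n w \<mu> S | S. S \<subseteq> {1..n} \<and> (\<Sum>i\<in>S. c i) \<le> C}"
  have "finite ?X" by (rule finite_subset[of _ "completion_cost n w \<mu> ` Pow {1..n}"]) auto
  moreover have "completion_cost n w \<mu> {} \<in> ?X" using budget_nonneg by force
  ultimately have "G_star n w \<mu> c C \<in> ?X" unfolding G_star_def by (intro Min_in) auto
  then obtain T where T: "T \<subseteq> {1..n}" "(\<Sum>i\<in>T. c i) \<le> C"
    "G_star n w \<mu> c C = completion_cost n w \<mu> T" by blast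
  have "of_int (\<Sum>i\<in>T. K i) \<le> (of_int B :: rat)"
    unfolding sum_K[OF T(1)] scaled_budget using T(2) D by (simp add: mult.commute)
  then have "(\<Sum>i\<in>T. K i) \<le> B" by (simp only: of_int_le_iff)
  from opt[OF T(1) this]
  have "of_int (free_cost n A S) \<le> (of_int (3 * free_cost n A T) :: rat)"
    by (simp only: of_int_le_iff)
  then have "3 * (of_int D)\<^sup>2 * completion_cost n w \<mu> S
      \<le> 3 * (of_int D)\<^sup>2 * (3 * completion_cost n w \<mu> T)"
    using completion_cost_edges[OF S(1)] completion_cost_edges[OF T(1)] by simp
  moreover have "3 * (of_int D)\<^sup>2 > (0::rat)" using D by simp
  ultimately show "completion_cost n w \<mu> S \<le> 3 * G_star n w \<mu> c C"
    unfolding T(3) by (simp only: mult_le_cancel_left_pos)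
qed

end

section \<open>The program\<close>

text \<open>Cells of the store: \<open>d\<close> common denominator, \<open>z\<close> sum of all numerators, \<open>l\<close> and \<open>h\<close> bounds
  of the binary search for \<open>g\<close>, \<open>r\<close> slacks, \<open>y\<close> current dual variable, \<open>q\<close> cost of the discarded
  jobs. Entry 0 of the input is the budget; entries \<open>3 i - 2\<close>, \<open>3 i - 1\<close>, \<open>3 i\<close> belong to job \<open>i\<close>.\<close>

definition Var :: "name \<Rightarrow> aexp" where "Var x = Cell x (Const 0)"
definition Set :: "name \<Rightarrow> aexp \<Rightarrow> com" where "Set x e = Assign x (Const 0) e"
definition Minimize :: "name \<Rightarrow> aexp \<Rightarrow> com" where
  "Minimize x e = Cond (Less e (Var x)) (Set x e) Skip"

definition Num :: "aexp \<Rightarrow> aexp" where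
  "Num e = Cell ''in'' (Add (Mul (Const 2) e) (Const 1))"
definition Den :: "aexp \<Rightarrow> aexp" where
  "Den e = Cell ''in'' (Add (Mul (Const 2) e) (Const 2))"
definition Scaled :: "aexp \<Rightarrow> aexp" where
  "Scaled e = Div (Mul (Num e) (Var ''d'')) (Den e)"
definition Wexp :: "name \<Rightarrow> aexp" where
  "Wexp x = Scaled (Sub (Mul (Const 3) (Var x)) (Const 2))"
definition Mexp :: "name \<Rightarrow> aexp" where
  "Mexp x = Scaled (Sub (Mul (Const 3) (Var x)) (Const 1))"
definition Kexp :: "name \<Rightarrow> aexp" where
  "Kexp x = Scaled (Mul (Const 3) (Var x))"
definition Bexp :: aexp where
  "Bexp = Scaled (Const 0)"
text \<open>Loops stop before their limit, so \<open>n + 1\<close> is needed to reach job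
  \<open>n\<close>.\<close>

definition Limit :: aexp where
  "Limit = Add (Cell ''in'' (Const 0)) (Const 1)"

text \<open>The counter \<open>i\<close> and the sum \<open>z\<close> start from the initial 0 of
  their cells, so the loop runs over the entries 0 to \<open>3 * n\<close>.\<close>

definition prepare :: com where
  "prepare =
     Seq (Set ''d'' (Const 1))
    (Seq (For ''i'' (Add (Mul (Const 3) (Cell ''in'' (Const 0))) (Const 1))
       (Seq (Set ''d'' (Mul (Var ''d'') (Den (Var ''i''))))
            (Set ''z'' (Add (Var ''z'') (Num (Var ''i''))))))
     (Set ''h'' (Add (Mul (Const 3) (Mul (Mul (Var ''z'') (Var ''z'')) (Mul (Var ''d'') (Var ''d''))))
       (Const 2))))"

definition init_slacks :: com where
  "init_slacks =
     Seq (Set ''i'' (Const 1))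
     (For ''i'' Limit (Assign ''r'' (Var ''i'') (Mul (Mul (Const 2) (Var ''g'')) (Kexp ''i''))))"

text \<open>As \<open>A\<close> is itself a minimum, the first two commands compute
  \<open>B * A (i, j)\<close>. For \<open>i = j\<close> the guard prevents a second subtraction, in
  accordance with \<open>load\<close>.\<close>

definition relax :: com where
  "relax =
     Seq (Set ''y'' (Mul Bexp (Mul (Const 3) (Mul (Wexp ''j'') (Mexp ''i'')))))
    (Seq (Minimize ''y'' (Mul Bexp (Mul (Const 3) (Mul (Wexp ''i'') (Mexp ''j'')))))
    (Seq (Minimize ''y'' (Cell ''r'' (Var ''i'')))
    (Seq (Minimize ''y'' (Cell ''r'' (Var ''j'')))
    (Seq (Assign ''r'' (Var ''i'') (Sub (Cell ''r'' (Var ''i'')) (Var ''y'')))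
         (Cond (Less (Var ''i'') (Var ''j''))
           (Assign ''r'' (Var ''j'') (Sub (Cell ''r'' (Var ''j'')) (Var ''y''))) Skip)))))"

definition greedy :: com where
  "greedy =
     Seq (Set ''i'' (Const 1))
     (For ''i'' Limit (Seq (Set ''j'' (Var ''i'')) (For ''j'' Limit relax)))"

text \<open>Slacks are nonnegative integers, so the comparison with 1 tests for zero.\<close>

definition total_K :: com where
  "total_K =
     Seq (Set ''q'' (Const 0))
    (Seq (Set ''i'' (Const 1))
     (For ''i'' Limit (Cond (Less (Cell ''r'' (Var ''i'')) (Const 1))
       (Set ''q'' (Add (Var ''q'') (Kexp ''i''))) Skip)))"

definition write_out :: com where
  "write_out =
     Seq (Set ''i'' (Const 1))
     (For ''i'' Limit (Cond (Less (Cell ''r'' (Var ''i'')) (Const 1))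
       (Assign ''out'' (Var ''i'') (Const 1)) (Assign ''out'' (Var ''i'') (Const 0))))"

text \<open>The output is rewritten whenever \<open>h\<close> moves, so from the first such move on
  it belongs to the multiplier in \<open>h\<close>.\<close>

definition decide :: com where
  "decide = Cond (Less (Mul (Const 3) Bexp) (Var ''q''))
     (Set ''l'' (Var ''g'')) (Seq (Set ''h'' (Var ''g'')) write_out)"

definition probe :: com where
  "probe = Seq (Set ''g'' (Div (Add (Var ''l'') (Var ''h'')) (Const 2)))
     (Seq init_slacks (Seq greedy (Seq total_K decide)))"

definition search :: com where
  "search = While (Less (Add (Var ''l'') (Const 1)) (Var ''h''))
     probe"

definition outlier_program :: com where
  "outlier_program = Seq prepare search"

lemma aval_Var [simp]: "aval (Var x) s = s x 0"
  by (simp add: Var_def)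

lemma assigned_simps [simp]:
  "assigned (Set x e) = {x}" "assigned (Minimize x e) = {x}"
  by (simp_all add: Set_def Minimize_def)

lemma assigned_parts:
  "assigned init_slacks = {''i'', ''r''}" "assigned relax = {''y'', ''r''}"
  "assigned greedy = {''i'', ''j'', ''y'', ''r''}" "assigned total_K = {''q'', ''i''}"
  "assigned write_out = {''i'', ''out''}"
  by (auto simp: init_slacks_def relax_def greedy_def total_K_def write_out_def)

lemma spec_Set:
  "\<bar>aval e s\<bar> < 2 ^ l \<Longrightarrow> Q (s(x := (s x)(0 := aval e s))) \<Longrightarrow> spec l s (Set x e) Q"
  unfolding Set_def by (rule spec_Assign) auto

lemma spec_Minimize:
  assumes "\<bar>aval e s\<bar> < 2 ^ l" "Q (s(x := (s x)(0 := min (s x 0) (aval e s))))"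
  shows "spec l s (Minimize x e) Q"
  unfolding Minimize_def
proof (rule spec_Cond)
  assume "bval (Less e (Var x)) s"
  then show "spec l s (Set x e) Q" using assms by (intro spec_Set) (auto simp: min_def)
next
  assume "\<not> bval (Less e (Var x)) s"
  then show "spec l s Skip Q" using assms by (intro spec_Skip) (auto simp: min_def)
qed

section \<open>Correctness of the subprograms on an encoded instance\<close>

context outlier_instance
begin

text \<open>One number limits both the length of stored integers and the iterations of every loop.
  The largest bound below is \<open>10 * U ^ 8\<close>, for the slacks; the summand 10 leaves room
  for the constant.\<close>

definition L :: nat where "L = 8 * N + 10"

definition ready :: "store \<Rightarrow> bool" where
  "ready s \<longleftrightarrow> s ''in'' = initial_store input ''in'' \<and> s ''d'' 0 = D"

lemma two_power_L: "(2::int) ^ L = 1024 * U ^ 8"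
  by (simp add: L_def U_def power_add power_mult mult.commute[of 8])

lemma U_powers: "1 \<le> U ^ k" "k \<le> m \<Longrightarrow> U ^ k \<le> U ^ m"
  using U_ge by (auto intro: one_le_power power_increasing)

lemma N_le_L: "N \<le> L"
  by (simp add: L_def)

lemma n_le_L: "3 * n + 1 \<le> L"
  using N_ge N_le_L by linarith

lemma n_less: "int n + 1 < 2 ^ L" "3 * int n + 1 < 2 ^ L"
  using U_ge U_powers(2)[of 1 8] U_powers(1)[of 8] by (auto simp: two_power_L)

lemma ready_agree: "agree P s s' \<Longrightarrow> ready s \<Longrightarrow> ''in'' \<notin> assigned P \<Longrightarrow> ''d'' \<notin> assigned P \<Longrightarrow> ready s'"
  by (simp add: ready_def agree_def)

lemma aval_Scaled: "ready s \<Longrightarrow> aval e s = int k \<Longrightarrow> k \<le> 3 * n \<Longrightarrow> aval (Scaled e) s = scaled k"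
  by (simp add: Scaled_def Num_def Den_def ready_def input_cells scaled_def)

lemma aval_job:
  assumes "ready s" "s x 0 = int i" "i \<in> {1..n}"
  shows "aval (Wexp x) s = W i" "aval (Mexp x) s = M i" "aval (Kexp x) s = K i"
  unfolding Wexp_def Mexp_def Kexp_def W_def M_def K_def
  using assms by (auto intro!: aval_Scaled simp: of_nat_diff)

lemma aval_Bexp: "ready s \<Longrightarrow> aval Bexp s = B"
  unfolding Bexp_def B_def by (rule aval_Scaled) auto

lemma aval_Limit: "ready s \<Longrightarrow> aval Limit s = int (n + 1)"
  by (simp add: Limit_def ready_def input_cells)

text \<open>The start \<open>a\<close> is arbitrary because the inner loop of \<open>greedy\<close>
  begins at the diagonal.\<close>

lemma spec_jobs_loop:
  assumes "ready s" "s x 0 = int a" "a \<le> n + 1" "I a s"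
    and disj: "{''in'', ''d''} \<inter> insert x (assigned P) = {}"
    and step: "\<And>k s'. a \<le> k \<Longrightarrow> k \<le> n \<Longrightarrow> agree (For x Limit P) s s' \<Longrightarrow> ready s' \<Longrightarrow> I k s' \<Longrightarrow>
      s' x 0 = int k \<Longrightarrow> bounded L s' \<Longrightarrow>
      spec L s' P (\<lambda>s2. s2 x 0 = int k \<and> I (Suc k) (s2(x := (s2 x)(0 := int (Suc k)))))"
    and post: "\<And>s'. agree (For x Limit P) s s' \<Longrightarrow> I (n + 1) s' \<Longrightarrow> Q s'"
  shows "spec L s (For x Limit P) Q"
proof (rule spec_For[where I = I and a = a and b = "n + 1"])
  show "aval Limit s' = int (n + 1)" if "agree (For x Limit P) s s'" for s'
    using aval_Limit[OF ready_agree[OF that assms(1)]] disj by auto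
  show "n + 1 \<le> L" using n_le_L by simp
next
  fix k s' assume "agree (For x Limit P) s s'"
  then have "ready s'" using ready_agree assms(1) disj by auto
  then show "a \<le> k \<Longrightarrow> k < n + 1 \<Longrightarrow> agree (For x Limit P) s s' \<Longrightarrow> I k s' \<Longrightarrow>
      s' x 0 = int k \<Longrightarrow> bounded L s' \<Longrightarrow>
      spec L s' P (\<lambda>s2. s2 x 0 = int k \<and> I (Suc k) (s2(x := (s2 x)(0 := int (Suc k)))))"
    using step[of k s'] by simp
qed (use assms in auto)

lemma spec_prepare:
  "spec L (initial_store input) prepare (\<lambda>s. ready s \<and> s ''h'' 0 = H)"
proof -
  have pos: "0 < U ^ k" for k using U_ge by simp
  have small: "\<bar>x\<bar> < 2 ^ L" if "0 \<le> x" "x \<le> 5 * U ^ 6" for x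
    using that U_powers(2)[of 6 8] pos[of 8] unfolding two_power_L by linarith
  let ?I = "\<lambda>k s. s ''d'' 0 = (\<Prod>i<k. den i) \<and> s ''z'' 0 = (\<Sum>i<k. num i)"
  have "U \<le> U ^ 6" "U\<^sup>2 \<le> U ^ 6" using U_powers(2)[of 1 6] U_powers(2)[of 2 6] by simp_all
  then have le: "x \<le> 5 * U ^ 6" if "x \<le> U \<or> x \<le> U\<^sup>2" for x
    using that U_powers(1)[of 6] by linarith
  show ?thesis
    unfolding prepare_def
    apply (rule spec_Seq, rule spec_Set)
     apply (simp add: small[of 1, simplified] two_power_L)
    subgoal using U_powers(1)[of 8] by linarith
    apply (rule spec_Seq)
    apply (rule spec_For[where I = ?I and a = 0 and b = "3 * n + 1"])
    subgoal by (simp add: agree_def input_cells)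
    subgoal by (rule n_le_L)
    subgoal by (simp add: initial_store_def)
    subgoal by simp
    subgoal by (simp add: initial_store_def)
    subgoal premises p for k s'
    proof -
      have i: "s' ''in'' = initial_store input ''in''" using p(3) by (simp add: agree_def)
      have k: "k \<le> 3 * n" "Suc k \<le> 3 * n + 1" using p(2) by auto
      note P = prod_den[OF k(2)] sum_num_le[OF k(2)]
      have 1: "\<bar>(\<Prod>i<k. den i) * den k\<bar> < 2 ^ L"
        using P by (intro small le) auto
      have 2: "\<bar>(\<Sum>i<k. num i) + num k\<bar> < 2 ^ L"
        using P by (intro small le) auto
      show ?thesis
        apply (rule spec_Seq, rule spec_Set)
        subgoal using p(4,5) 1 k by (simp add: Den_def i input_cells)
        apply (rule spec_Set)
        subgoal using p(4,5) 2 k by (simp add: Num_def i input_cells)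
        subgoal using p(4,5) k by (simp add: Num_def Den_def i input_cells)
        done
    qed
    subgoal for s'
      apply (rule spec_Set)
      subgoal using small[of H] H_bounds by (simp add: H_def D_def Z_def)
      subgoal by (simp add: ready_def agree_def H_def D_def Z_def)
      done
    done
qed

lemma spec_init_slacks:
  assumes "ready s" "0 \<le> s ''g'' 0" "s ''g'' 0 \<le> H"
  shows "spec L s init_slacks (\<lambda>s'. \<forall>i\<in>{1..n}. s' ''r'' (int i) = 2 * s ''g'' 0 * K i)"
  unfolding init_slacks_def
  apply (rule spec_Seq, rule spec_Set)
  subgoal using n_less(1) by simp
  apply (rule spec_jobs_loop[where a = 1 and
        I = "\<lambda>k s'. \<forall>i\<in>{1..<k}. s' ''r'' (int i) = 2 * s ''g'' 0 * K i"])
  subgoal using assms(1) by (simp add: ready_def)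
  subgoal by simp
  subgoal by simp
  subgoal by simp
  subgoal by simp
  subgoal premises p for k s'
  proof -
    have k: "k \<in> {1..n}" using p by simp
    have g: "s' ''g'' 0 = s ''g'' 0" using p(3) by (simp add: agree_def)
    \<comment> \<open>\<open>g \<le> H\<close> contributes \<open>U ^ 6\<close> and
      \<open>K k\<close> contributes \<open>U ^ 2\<close>, whence the factor 8 in
      \<open>L\<close>.\<close>
    have "2 * s ''g'' 0 * K k \<le> 2 * (5 * U ^ 6) * U\<^sup>2"
      using assms H_bounds job_bounds[OF k] U_powers(1)[of 6] by (intro mult_mono) auto
    also have "\<dots> = 10 * (U ^ 6 * U ^ 2)" by simp
    also have "\<dots> = 10 * U ^ 8" by (simp only: power_add[symmetric]) simp
    finally have "2 * s ''g'' 0 * K k < 2 ^ L"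
      using U_powers(1)[of 8] unfolding two_power_L by linarith
    moreover have "0 \<le> 2 * s ''g'' 0 * K k" using assms job_bounds[OF k] by simp
    ultimately show ?thesis
      apply (intro spec_Assign)
      subgoal using aval_job(3)[OF p(4,6) k] by (simp add: g)
      subgoal using aval_job(3)[OF p(4,6) k] p(5,6) by (auto simp: g less_Suc_eq)
      done
  qed
  subgoal by auto
  done

lemma spec_relax:
  assumes s: "ready s" "bounded L s" "s ''i'' 0 = int i" "s ''j'' 0 = int j"
    and e: "(i, j) \<in> edges n" and r: "0 \<le> s ''r'' (int i)" "0 \<le> s ''r'' (int j)"
  shows "spec L s relax (\<lambda>s'. \<forall>k. s' ''r'' (int k) = s ''r'' (int k) -
    (if k = i \<or> k = j then min (B * A (i, j)) (min (s ''r'' (int i)) (s ''r'' (int j))) else 0))"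
proof -
  have ij: "i \<in> {1..n}" "j \<in> {1..n}" "i \<le> j" using e by (auto simp: edges_def)
  let ?a = "B * (3 * (W j * M i))" and ?b = "B * (3 * (W i * M j))"
  have ab: "\<bar>B * (3 * (W k * M m))\<bar> < 2 ^ L" if k: "k \<in> {1..n}" "m \<in> {1..n}" for k m
  proof -
    have "B * (3 * (W k * M m)) \<le> U\<^sup>2 * (3 * (U\<^sup>2 * U\<^sup>2))"
      using B_bounds job_bounds[OF k(1)] job_bounds[OF k(2)] by (intro mult_mono) auto
    also have "\<dots> = 3 * (U\<^sup>2 * U\<^sup>2 * U\<^sup>2)" by simp
    also have "\<dots> = 3 * U ^ 6" by (simp only: power_add[symmetric]) simp
    finally have "B * (3 * (W k * M m)) < 2 ^ L"
      using U_powers(2)[of 6 8] U_powers(1)[of 8] unfolding two_power_L by simp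
    moreover have "0 \<le> B * (3 * (W k * M m))"
      using B_bounds job_bounds[OF k(1)] job_bounds[OF k(2)] by simp
    ultimately show ?thesis by simp
  qed
  have A: "B * A (i, j) = min ?a ?b" "0 \<le> ?a" "0 \<le> ?b"
    using B_bounds job_bounds[OF ij(1)] job_bounds[OF ij(2)]
    by (simp_all add: A_def min_mult_distrib_left)
  have rl: "\<bar>s ''r'' x\<bar> < 2 ^ L" for x using s(2) by (simp add: bounded_def)
  define d where "d = min (min (min ?a ?b) (s ''r'' (int i))) (s ''r'' (int j))"
  have d_eq: "min (B * A (i, j)) (min (s ''r'' (int i)) (s ''r'' (int j))) = d"
    by (simp only: A(1) d_def min.assoc)
  have d: "0 \<le> d" "d \<le> s ''r'' (int i)" "d \<le> s ''r'' (int j)"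
    unfolding d_def using A(2,3) r
    by (simp, intro min.coboundedI1 min.cobounded2, intro min.cobounded2)
  have rd: "\<bar>s ''r'' (int i) - d\<bar> < 2 ^ L" "\<bar>s ''r'' (int j) - d\<bar> < 2 ^ L"
    using d rl[of "int i"] rl[of "int j"] by linarith+
  let ?Q = "\<lambda>s'. \<forall>k. s' ''r'' (int k) = s ''r'' (int k) - (if k = i \<or> k = j then d else 0)"
  \<comment> \<open>Stated for any new contents \<open>f\<close> of the array \<open>y\<close>, so
    that it applies after the three nested minimisations; only cell 0 matters.\<close>
  have tail: "spec L (s(''y'' := f))
      (Seq (Assign ''r'' (Var ''i'') (Sub (Cell ''r'' (Var ''i'')) (Var ''y'')))
         (Cond (Less (Var ''i'') (Var ''j''))
           (Assign ''r'' (Var ''j'') (Sub (Cell ''r'' (Var ''j'')) (Var ''y''))) Skip)) ?Q"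
    if f: "f 0 = d" for f
  proof (rule spec_Seq, rule spec_Assign)
    show "\<bar>aval (Sub (Cell ''r'' (Var ''i'')) (Var ''y'')) (s(''y'' := f))\<bar> < 2 ^ L"
      using rd(1) by (simp add: s(3) f)
    let ?s = "s(''y'' := f, ''r'' := (s ''r'')(int i := s ''r'' (int i) - d))"
    have "spec L ?s (Cond (Less (Var ''i'') (Var ''j''))
           (Assign ''r'' (Var ''j'') (Sub (Cell ''r'' (Var ''j'')) (Var ''y''))) Skip) ?Q"
    proof (rule spec_Cond)
      assume "bval (Less (Var ''i'') (Var ''j'')) ?s"
      then have ne: "j \<noteq> i" by (simp add: s(3,4))
      show "spec L ?s (Assign ''r'' (Var ''j'') (Sub (Cell ''r'' (Var ''j'')) (Var ''y''))) ?Q"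
        using rd(2) ne by (intro spec_Assign) (simp_all add: s(3,4) f)
    next
      assume "\<not> bval (Less (Var ''i'') (Var ''j'')) ?s"
      then have "j = i" using ij(3) by (simp add: s(3,4))
      then show "spec L ?s Skip ?Q" by (intro spec_Skip) simp
    qed
    then show "spec L ((s(''y'' := f))(''r'' := ((s(''y'' := f)) ''r'')
        (aval (Var ''i'') (s(''y'' := f)) :=
          aval (Sub (Cell ''r'' (Var ''i'')) (Var ''y'')) (s(''y'' := f)))))
        (Cond (Less (Var ''i'') (Var ''j''))
           (Assign ''r'' (Var ''j'') (Sub (Cell ''r'' (Var ''j'')) (Var ''y''))) Skip) ?Q"
      by (simp add: s(3) f)
  qed
  have ready': "ready (s(''y'' := f))" for f using s(1) by (simp add: ready_def)
  note av = aval_job[OF s(1,3) ij(1)] aval_job[OF s(1,4) ij(2)] aval_Bexp[OF s(1)]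
  note av' = aval_job[OF ready' _ ij(1), of _ "''i''"] aval_job[OF ready' _ ij(2), of _ "''j''"]
    aval_Bexp[OF ready']
  show ?thesis
    unfolding relax_def d_eq
    apply (rule spec_Seq, rule spec_Set)
    subgoal using ab[OF ij(2,1)] by (simp add: av)
    apply (rule spec_Seq, rule spec_Minimize)
    subgoal using ab[OF ij(1,2)] s by (simp add: av')
    apply (rule spec_Seq, rule spec_Minimize)
    subgoal using rl s by simp
    apply (rule spec_Seq, rule spec_Minimize)
    subgoal using rl s by simp
    subgoal
      unfolding fun_upd_upd
      by (rule tail) (simp add: av av' s(3,4) d_def)
    done
qed

lemma spec_greedy:
  assumes "ready s" "0 \<le> g" "\<forall>i\<in>{1..n}. s ''r'' (int i) = 2 * g * K i"
  shows "spec L s greedy (\<lambda>s'. dual_state n A K B g (edges n) (\<lambda>i. s' ''r'' (int i)))"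
proof -
  \<comment> \<open>The pairs lexicographically before \<open>(i, j)\<close>: those processed when
    the counters stand at \<open>i\<close> and \<open>j\<close>.\<close>
  let ?F = "\<lambda>i j. {e \<in> edges n. fst e < i \<or> fst e = i \<and> snd e < j}"
  let ?I = "\<lambda>i j s'. dual_state n A K B g (?F i j) (\<lambda>i. s' ''r'' (int i))"
  show ?thesis
    unfolding greedy_def
    apply (rule spec_Seq, rule spec_Set)
    subgoal using n_less(1) by simp
    apply (rule spec_jobs_loop[where a = 1 and I = "\<lambda>i. ?I i i"])
    subgoal using assms(1) by (simp add: ready_def)
    subgoal by simp
    subgoal by simp
    subgoal premises p
    proof -
      have "?F 1 1 = {}" by (auto simp: edges_def)
      then show ?thesis
        by (simp only:) (rule dual_state_init,
          use assms A_nonneg B_bounds job_bounds in auto)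
    qed
    subgoal by (simp add: assigned_parts)
    subgoal premises p for i s1
      apply (rule spec_Seq, rule spec_Set)
      subgoal using p(2,6) n_less(1) by (simp del: of_nat_less_numeral_power_cancel_iff)
      apply (rule spec_jobs_loop[where a = i and I = "?I i"])
      subgoal using p(4) by (simp add: ready_def)
      subgoal using p(6) by simp
      subgoal using p(2) by simp
      subgoal using p(5) by simp
      subgoal by (simp add: assigned_parts)
      subgoal premises q for j s2
      proof -
        have e: "(i, j) \<in> edges n" using p q by (auto simp: edges_def)
        then have ij: "i \<in> {1..n}" "j \<in> {1..n}" by (auto simp: edges_def)
        have i: "s2 ''i'' 0 = int i" using q(3) p(6) by (simp add: agree_def assigned_parts)
        have F: "?F i (Suc j) = insert (i, j) (?F i j)" using e by auto
        show ?thesis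
        proof (rule spec_conseq, rule spec_relax[OF q(4,7) i q(6) e])
          show "0 \<le> s2 ''r'' (int i)" "0 \<le> s2 ''r'' (int j)"
            using dual_state_bounds(1)[OF q(5)] ij by auto
        next
          fix s3
          assume a: "agree relax s2 s3" and r: "\<forall>k. s3 ''r'' (int k) = s2 ''r'' (int k) -
            (if k = i \<or> k = j then min (B * A (i, j)) (min (s2 ''r'' (int i)) (s2 ''r'' (int j))) else 0)"
          have "?I i (Suc j) s3"
            unfolding F using e r A_nonneg[OF e] B_bounds
            by (intro dual_state_step[OF q(5)]) auto
          then show "s3 ''j'' 0 = int j \<and> ?I i (Suc j) (s3(''j'' := (s3 ''j'')(0 := int (Suc j))))"
            using a q(6) by (simp add: agree_def assigned_parts)
        qed
      qed
      subgoal premises q for s2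
      proof -
        \<comment> \<open>The end of a row is the start of the next one: no edge has its second end
          beyond \<open>n\<close> or below its first end.\<close>
        have "?F i (n + 1) = ?F (Suc i) (Suc i)" by (auto simp: edges_def)
        then show ?thesis using q p(6) by (simp add: agree_def assigned_parts)
      qed
      done
    subgoal premises p for s1
    proof -
      have "?F (n + 1) (n + 1) = edges n" by (auto simp: edges_def)
      then show ?thesis using p by simp
    qed
    done
qed

lemma spec_total_K:
  assumes "ready s" "\<forall>i\<in>{1..n}. 0 \<le> s ''r'' (int i)"
  shows "spec L s total_K (\<lambda>s'. s' ''q'' 0 = (\<Sum>i\<in>{i\<in>{1..n}. s ''r'' (int i) = 0}. K i))"
proof -
  let ?S = "\<lambda>k. {i\<in>{1..<k}. s ''r'' (int i) = 0}"
  have bound: "\<bar>\<Sum>i\<in>?S k. K i\<bar> < 2 ^ L" if "k \<le> n + 1" for k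
  proof -
    have "(\<Sum>i\<in>?S k. K i) \<le> (\<Sum>i\<in>{1..n}. K i)"
      using that job_bounds by (intro sum_mono2) auto
    also have "\<dots> \<le> (\<Sum>i\<in>{1..n}. U\<^sup>2)" using job_bounds by (intro sum_mono) auto
    also have "\<dots> = int n * U\<^sup>2" by simp
    also have "\<dots> \<le> U * U\<^sup>2" using U_ge by (intro mult_right_mono) auto
    also have "\<dots> = U ^ 3" by (simp add: power3_eq_cube power2_eq_square)
    finally have "(\<Sum>i\<in>?S k. K i) < 2 ^ L"
      using U_powers(2)[of 3 8] U_powers(1)[of 8] unfolding two_power_L by simp
    moreover have "0 \<le> (\<Sum>i\<in>?S k. K i)"
      using that job_bounds by (intro sum_nonneg) auto
    ultimately show ?thesis by simp
  qed
  show ?thesis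
    unfolding total_K_def
    apply (rule spec_Seq, rule spec_Set)
    subgoal by simp
    apply (rule spec_Seq, rule spec_Set)
    subgoal using n_less(1) by simp
    apply (rule spec_jobs_loop[where a = 1 and I = "\<lambda>k s'. s' ''q'' 0 = (\<Sum>i\<in>?S k. K i)"])
    subgoal using assms(1) by (simp add: ready_def)
    subgoal by simp
    subgoal by simp
    subgoal by simp
    subgoal by simp
    subgoal premises p for k s'
    proof -
      have k: "k \<in> {1..n}" using p by simp
      have r: "s' ''r'' (int k) = s ''r'' (int k)" using p(3) by (simp add: agree_def)
      have r0: "0 \<le> s ''r'' (int k)" using assms(2) k by blast
      show ?thesis
      proof (rule spec_Cond)
        assume "bval (Less (Cell ''r'' (Var ''i'')) (Const 1)) s'"
        then have "?S (Suc k) = insert k (?S k)" using r r0 p(1,6) by (auto simp: less_Suc_eq)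
        then have S: "(\<Sum>i\<in>?S (Suc k). K i) = (\<Sum>i\<in>?S k. K i) + K k" by simp
        show "spec L s' (Set ''q'' (Add (Var ''q'') (Kexp ''i'')))
          (\<lambda>s2. s2 ''i'' 0 = int k \<and>
            (s2(''i'' := (s2 ''i'')(0 := int (Suc k)))) ''q'' 0 = (\<Sum>i\<in>?S (Suc k). K i))"
          apply (rule spec_Set)
          subgoal using bound[of "Suc k"] p aval_job(3)[OF p(4,6) k] unfolding S by simp
          subgoal using p(5,6) aval_job(3)[OF p(4,6) k] unfolding S by simp
          done
      next
        assume "\<not> bval (Less (Cell ''r'' (Var ''i'')) (Const 1)) s'"
        then have "?S (Suc k) = ?S k" using r p(6) by (auto simp: less_Suc_eq)
        then show "spec L s' Skip
          (\<lambda>s2. s2 ''i'' 0 = int k \<and>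
            (s2(''i'' := (s2 ''i'')(0 := int (Suc k)))) ''q'' 0 = (\<Sum>i\<in>?S (Suc k). K i))"
          using p(5,6) by (intro spec_Skip) simp
      qed
    qed
    subgoal by (simp add: atLeastLessThanSuc_atLeastAtMost)
    done
qed

lemma spec_write_out:
  assumes "ready s" "\<forall>i\<in>{1..n}. 0 \<le> s ''r'' (int i)"
  shows "spec L s write_out
    (\<lambda>s'. \<forall>i\<in>{1..n}. s' ''out'' (int i) = (if s ''r'' (int i) = 0 then 1 else 0))"
  unfolding write_out_def
  apply (rule spec_Seq, rule spec_Set)
  subgoal using n_less(1) by simp
  apply (rule spec_jobs_loop[where a = 1 and I = "\<lambda>k s'. \<forall>i\<in>{1..<k}.
        s' ''out'' (int i) = (if s ''r'' (int i) = 0 then 1 else 0)"])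
  subgoal using assms(1) by (simp add: ready_def)
  subgoal by simp
  subgoal by simp
  subgoal by simp
  subgoal by simp
  subgoal premises p for k s'
  proof -
    have r: "s' ''r'' (int k) = s ''r'' (int k)" using p(3) by (simp add: agree_def)
    have r0: "0 \<le> s ''r'' (int k)" using assms(2) p by simp
    show ?thesis
      apply (rule spec_Cond)
      subgoal
        apply (rule spec_Assign)
        subgoal using n_less(1) by simp
        subgoal using p(5,6) r r0 by (auto simp: less_Suc_eq)
        done
      subgoal
        apply (rule spec_Assign)
        subgoal by simp
        subgoal using p(5,6) r r0 by (auto simp: less_Suc_eq)
        done
      done
  qed
  subgoal by auto
  done

section \<open>Binary search for the multiplier\<close>

definition selects :: "int \<Rightarrow> nat set \<Rightarrow> bool" where
  "selects g S \<longleftrightarrow> (\<exists>r. dual_state n A K B g (edges n) r \<and> S = {i\<in>{1..n}. r i = 0})"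

text \<open>The empty set is affordable and costs at most \<open>H - 2\<close>, so
  \<open>dual_budget\<close> applies with \<open>T = {}\<close>. Hence the search cannot end with
  \<open>l = H - 1\<close>.\<close>

lemma selects_H:
  assumes "selects (H - 1) S" shows "(\<Sum>i\<in>S. K i) \<le> 3 * B"
proof -
  obtain r where r: "dual_state n A K B (H - 1) (edges n) r" "S = {i\<in>{1..n}. r i = 0}"
    using assms by (auto simp: selects_def)
  show ?thesis unfolding r(2)
    by (rule dual_budget[OF r(1) A_nonneg, where T = "{}"])
      (use B_bounds H_bounds free_cost_empty_le in auto)
qed

lemma selects_approx:
  assumes "selects g S" "0 < g" "g = 1 \<or> (\<exists>S'. selects (g - 1) S' \<and> 3 * B < (\<Sum>i\<in>S'. K i))"
    "(\<Sum>i\<in>S. K i) \<le> 3 * B"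
  shows "(\<Sum>i\<in>S. c i) \<le> 3 * C" "completion_cost n w \<mu> S \<le> 3 * G_star n w \<mu> c C"
proof -
  obtain r where r: "dual_state n A K B g (edges n) r" "S = {i\<in>{1..n}. r i = 0}"
    using assms(1) by (auto simp: selects_def)
  have sub: "S \<subseteq> {1..n}" using r by auto
  have "free_cost n A S \<le> 3 * free_cost n A T" if "T \<subseteq> {1..n}" "(\<Sum>i\<in>T. K i) \<le> B" for T
    using assms(2,3) A_nonneg A_dvd B_bounds(1) job_bounds(3) that
    by (intro dual_approx[OF r(1) _ _ _ _ r(2)]) (auto simp: selects_def)
  from approx_from_dual[OF sub assms(4) this]
  show "(\<Sum>i\<in>S. c i) \<le> 3 * C" "completion_cost n w \<mu> S \<le> 3 * G_star n w \<mu> c C" by auto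
qed

text \<open>The index \<open>k\<close> is the variant: each probe halves the bound
  \<open>2 ^ k\<close> on the interval. The values \<open>l = 0\<close> and \<open>h = H\<close>
  stand for ends that no probe has moved yet.\<close>

definition search_inv :: "nat \<Rightarrow> store \<Rightarrow> bool" where
  "search_inv k s \<longleftrightarrow> ready s \<and> 0 \<le> s ''l'' 0 \<and> s ''l'' 0 < s ''h'' 0 \<and> s ''h'' 0 \<le> H \<and>
     s ''h'' 0 - s ''l'' 0 \<le> 2 ^ k \<and>
     (s ''l'' 0 = 0 \<or> (\<exists>S. selects (s ''l'' 0) S \<and> 3 * B < (\<Sum>i\<in>S. K i))) \<and>
     (s ''h'' 0 = H \<or>
       (\<exists>S. selects (s ''h'' 0) S \<and> (\<Sum>i\<in>S. K i) \<le> 3 * B \<and> outputs_set n s S))"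

definition good :: "store \<Rightarrow> bool" where
  "good s \<longleftrightarrow> (\<exists>S. outputs_set n s S \<and> (\<Sum>i\<in>S. c i) \<le> 3 * C \<and>
     completion_cost n w \<mu> S \<le> 3 * G_star n w \<mu> c C)"

lemma search_inv_good:
  assumes "search_inv k s" "\<not> s ''l'' 0 + 1 < s ''h'' 0"
  shows "good s"
proof -
  have h: "s ''l'' 0 = s ''h'' 0 - 1" "0 < s ''h'' 0" using assms by (auto simp: search_inv_def)
  have low: "s ''h'' 0 = 1 \<or> (\<exists>S'. selects (s ''h'' 0 - 1) S' \<and> 3 * B < (\<Sum>i\<in>S'. K i))"
    using assms h by (auto simp: search_inv_def)
  \<comment> \<open>If \<open>h = H\<close>, then \<open>l = H - 1\<close> would have exceeded
    \<open>3 * B\<close>, against \<open>selects_H\<close>; the alternative \<open>H = 1\<close> is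
    excluded by \<open>2 \<le> H\<close>.\<close>
  then have "s ''h'' 0 \<noteq> H" using H_bounds selects_H by force
  then obtain S where "selects (s ''h'' 0) S" "(\<Sum>i\<in>S. K i) \<le> 3 * B" "outputs_set n s S"
    using assms by (auto simp: search_inv_def)
  then show ?thesis using selects_approx[OF _ h(2) low] by (auto simp: good_def)
qed

lemma spec_search_body:
  assumes I: "search_inv (Suc k) s" and lt: "s ''l'' 0 + 1 < s ''h'' 0"
  shows "spec L s probe (search_inv k)"
proof -
  define lo hi where "lo = s ''l'' 0" and "hi = s ''h'' 0"
  define g where "g = (lo + hi) div 2"
  note I' = I[unfolded search_inv_def, folded lo_def hi_def]
  have lh: "lo + 1 < hi" using lt by (simp add: lo_def hi_def)
  have len: "hi - lo \<le> 2 * 2 ^ k" using I' by simp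
  \<comment> \<open>The interval has length at least 2, so the midpoint is strictly inside. Rounding
    does no harm to the lengths, as the bound \<open>2 * 2 ^ k\<close> is even.\<close>
  have g: "lo < g" "g < hi" "g - lo \<le> 2 ^ k" "hi - g \<le> 2 ^ k"
    using lh len unfolding g_def by linarith+
  have g0: "0 \<le> g" "g \<le> H" using g I' by auto
  have "H < 2 ^ L"
    using H_bounds U_powers(2)[of 6 8] U_powers(1)[of 8] unfolding two_power_L by linarith
  then have gL: "\<bar>g\<bar> < 2 ^ L" using g0 by simp
  \<comment> \<open>The phases between the choice of \<open>g\<close> and \<open>decide\<close>
    leave both ends, the multiplier and the previous output alone.\<close>
  have frame: "ready s' \<and> s' ''l'' 0 = lo \<and> s' ''h'' 0 = hi \<and> s' ''g'' 0 = g \<and> s' ''out'' = s ''out''"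
    if "agree P s0 s'" "{''in'', ''d'', ''l'', ''h'', ''g'', ''out''} \<inter> assigned P = {}"
      "ready s0 \<and> s0 ''l'' 0 = lo \<and> s0 ''h'' 0 = hi \<and> s0 ''g'' 0 = g \<and> s0 ''out'' = s ''out''" for P s0 s'
    using that by (auto simp: agree_def ready_def)
  let ?s0 = "s(''g'' := (s ''g'')(0 := g))"
  have f0: "ready ?s0 \<and> ?s0 ''l'' 0 = lo \<and> ?s0 ''h'' 0 = hi \<and> ?s0 ''g'' 0 = g \<and> ?s0 ''out'' = s ''out''"
    using I' by (simp add: ready_def lo_def hi_def)
  show ?thesis
    unfolding probe_def
  proof (rule spec_Seq, rule spec_Set)
    show "\<bar>aval (Div (Add (Var ''l'') (Var ''h'')) (Const 2)) s\<bar> < 2 ^ L"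
      using gL by (simp add: g_def lo_def hi_def)
    have "spec L ?s0 (Seq init_slacks (Seq greedy (Seq total_K decide))) (search_inv k)"
    proof (rule spec_Seq, rule spec_conseq[OF spec_init_slacks])
      show "ready ?s0" "0 \<le> ?s0 ''g'' 0" "?s0 ''g'' 0 \<le> H" using f0 g0 by auto
      fix s1 assume a1: "agree init_slacks ?s0 s1"
        and r1: "\<forall>i\<in>{1..n}. s1 ''r'' (int i) = 2 * ?s0 ''g'' 0 * K i"
      have f1: "ready s1 \<and> s1 ''l'' 0 = lo \<and> s1 ''h'' 0 = hi \<and> s1 ''g'' 0 = g \<and> s1 ''out'' = s ''out''"
        by (rule frame[OF a1 _ f0]) (simp add: assigned_parts)
      show "spec L s1 (Seq greedy (Seq total_K decide)) (search_inv k)"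
      proof (rule spec_Seq, rule spec_conseq[OF spec_greedy])
        show "ready s1" "0 \<le> g" "\<forall>i\<in>{1..n}. s1 ''r'' (int i) = 2 * g * K i"
          using f1 g0 r1 f0 by auto
        fix s2 assume a2: "agree greedy s1 s2"
          and r2: "dual_state n A K B g (edges n) (\<lambda>i. s2 ''r'' (int i))"
        have f2: "ready s2 \<and> s2 ''l'' 0 = lo \<and> s2 ''h'' 0 = hi \<and> s2 ''g'' 0 = g \<and> s2 ''out'' = s ''out''"
          by (rule frame[OF a2 _ f1]) (simp add: assigned_parts)
        define S where "S = {i\<in>{1..n}. s2 ''r'' (int i) = 0}"
        have sel: "selects g S" using r2 by (auto simp: selects_def S_def)
        have r0: "\<forall>i\<in>{1..n}. 0 \<le> s2 ''r'' (int i)" using dual_state_bounds(1)[OF r2] by blast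
        show "spec L s2 (Seq total_K decide) (search_inv k)"
        proof (rule spec_Seq, rule spec_conseq[OF spec_total_K])
          show "ready s2" "\<forall>i\<in>{1..n}. 0 \<le> s2 ''r'' (int i)" using f2 r0 by auto
          fix s3 assume a3: "agree total_K s2 s3"
            and q: "s3 ''q'' 0 = (\<Sum>i\<in>{i\<in>{1..n}. s2 ''r'' (int i) = 0}. K i)"
          have f3: "ready s3 \<and> s3 ''l'' 0 = lo \<and> s3 ''h'' 0 = hi \<and> s3 ''g'' 0 = g \<and> s3 ''out'' = s ''out''"
            by (rule frame[OF a3 _ f2]) (simp add: assigned_parts)
          have r3: "s3 ''r'' = s2 ''r''" using a3 by (simp add: agree_def assigned_parts)
          have B3: "aval Bexp s3 = B" using f3 aval_Bexp by blast
          show "spec L s3 decide (search_inv k)"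
            unfolding decide_def
          proof (rule spec_Cond)
            assume "bval (Less (Mul (Const 3) Bexp) (Var ''q'')) s3"
            then have "3 * B < (\<Sum>i\<in>S. K i)" using q B3 by (simp add: S_def)
            then have "\<exists>S. selects g S \<and> 3 * B < (\<Sum>i\<in>S. K i)" using sel by blast
            moreover have "hi = H \<or> (\<exists>S. selects hi S \<and> (\<Sum>i\<in>S. K i) \<le> 3 * B \<and>
                (\<forall>i\<in>{1..n}. s ''out'' (int i) = (if i \<in> S then 1 else 0)) \<and> S \<subseteq> {1..n})"
              using I' by (auto simp: outputs_set_def)
            ultimately show "spec L s3 (Set ''l'' (Var ''g'')) (search_inv k)"
              using f3 g g0 gL I'
              by (intro spec_Set) (auto simp: search_inv_def ready_def outputs_set_def)
          next
            assume "\<not> bval (Less (Mul (Const 3) Bexp) (Var ''q'')) s3"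
            then have KS: "(\<Sum>i\<in>S. K i) \<le> 3 * B" using q B3 by (simp add: S_def)
            let ?s4 = "s3(''h'' := (s3 ''h'')(0 := g))"
            have "spec L ?s4 write_out (search_inv k)"
            proof (rule spec_conseq[OF spec_write_out])
              show "ready ?s4" using f3 by (simp add: ready_def)
              show "\<forall>i\<in>{1..n}. 0 \<le> ?s4 ''r'' (int i)" using r0 r3 by simp
              fix s5 assume a5: "agree write_out ?s4 s5" and o: "\<forall>i\<in>{1..n}.
                s5 ''out'' (int i) = (if ?s4 ''r'' (int i) = 0 then 1 else 0)"
              have "outputs_set n s5 S"
                using o r3 by (auto simp: outputs_set_def S_def)
              moreover have "ready s5" "s5 ''l'' 0 = lo" "s5 ''h'' 0 = g"
                using a5 f3 by (auto simp: agree_def assigned_parts ready_def)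
              ultimately show "search_inv k s5"
                using I' g g0 sel KS unfolding search_inv_def by auto
            qed
            then show "spec L s3 (Seq (Set ''h'' (Var ''g'')) write_out) (search_inv k)"
              using f3 gL by (intro spec_Seq spec_Set) auto
          qed
        qed
      qed
    qed
    then show "spec L (s(''g'' := (s ''g'')(0 := aval (Div (Add (Var ''l'') (Var ''h'')) (Const 2)) s)))
        (Seq init_slacks (Seq greedy (Seq total_K decide))) (search_inv k)"
      by (simp add: g_def lo_def hi_def)
  qed
qed

lemma spec_search:
  assumes "search_inv L s"
  shows "spec L s search good"
  unfolding search_def
proof (rule spec_While[where I = search_inv, OF assms order_refl])
  fix k s'
  assume I: "search_inv k s'" and b: "bval (Less (Add (Var ''l'') (Const 1)) (Var ''h'')) s'"
  have lt: "s' ''l'' 0 + 1 < s' ''h'' 0" using b by simp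
  have "s' ''h'' 0 - s' ''l'' 0 \<le> 2 ^ k" using I by (simp add: search_inv_def)
  \<comment> \<open>A true guard means that the interval has length at least 2, which exceeds
    \<open>2 ^ 0\<close>.\<close>
  then have "k \<noteq> 0" using lt by (cases "k = 0") auto
  then obtain k' where "k = Suc k'" by (cases k) auto
  then show "\<exists>k'. k = Suc k' \<and> spec L s' probe (search_inv k')"
    using spec_search_body[where s = s', OF _ lt] I by blast
next
  fix k s'
  assume "search_inv k s'" "\<not> bval (Less (Add (Var ''l'') (Const 1)) (Var ''h'')) s'"
  then show "good s'" using search_inv_good by simp
qed

lemma spec_outlier_program: "spec L (initial_store input) outlier_program good"
  unfolding outlier_program_def
proof (rule spec_Seq, rule spec_conseq[OF spec_prepare])
  fix s assume a: "agree prepare (initial_store input) s" and s: "ready s \<and> s ''h'' 0 = H"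
  have "''l'' \<notin> assigned prepare" by (simp add: prepare_def)
  then have "s ''l'' 0 = 0" using a by (simp add: agree_def initial_store_def)
  \<comment> \<open>The initial interval from 0 to \<open>H\<close> is short enough for
    \<open>L\<close> halvings.\<close>
  moreover have "H \<le> 2 ^ L"
    using H_bounds U_powers(2)[of 6 8] U_powers(1)[of 8] unfolding two_power_L by linarith
  ultimately have "search_inv L s" using s H_bounds by (auto simp: search_inv_def)
  then show "spec L s search good" by (rule spec_search)
qed

lemma bounded_initial_L: "bounded L (initial_store input)"
proof -
  have "(2::int) ^ N \<le> 2 ^ L" using N_le_L by (intro power_increasing) auto
  then show ?thesis using bounded_initial unfolding bounded_def by (meson less_le_trans)
qed

lemma outlier_program_correct:
  "\<exists>t s. run outlier_program (initial_store input) t s \<and>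
     t \<le> time_bound L outlier_program * (L + 1) \<and> good s"
  using spec_outlier_program bounded_initial_L unfolding spec_def by blast

end

theorem theorem3:
  "\<exists>(P :: com) (p :: nat poly).
     \<forall>(n :: nat) (w :: nat \<Rightarrow> rat) (\<mu> :: nat \<Rightarrow> rat) (c :: nat \<Rightarrow> rat) (C :: rat).
       (\<forall>i\<in>{1..n}. w i > 0 \<and> \<mu> i \<ge> 0 \<and> c i \<ge> 0) \<and> C \<ge> 0 \<longrightarrow>
       (\<exists>t s S.
          run P (initial_store (encode_instance n w \<mu> c C)) t s \<and>
          t \<le> poly p (input_size (encode_instance n w \<mu> c C)) \<and>
          outputs_set n s S \<and>
          (\<Sum>i\<in>S. c i) \<le> 3 * C \<and>
          completion_cost n w \<mu> S \<le> 3 * G_star n w \<mu> c C)"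
proof -
  obtain q where q: "time_bound m outlier_program = poly q m" for m
    using time_bound_poly by blast
  \<comment> \<open>This is \<open>time_bound m outlier_program * (m + 1)\<close> with
    \<open>8 * N + 10\<close> substituted for \<open>m\<close>; the factor \<open>[:1, 1:]\<close>
    is \<open>m + 1\<close>.\<close>
  define p where "p = pcompose (q * [:1, 1:]) [:10, 8:]"
  have p: "poly p N = time_bound (8 * N + 10) outlier_program * (8 * N + 10 + 1)" for N
    by (simp add: p_def poly_pcompose q algebra_simps)
  show ?thesis
  proof (intro exI[of _ outlier_program] exI[of _ p] allI impI)
    fix n :: nat and w \<mu> c :: "nat \<Rightarrow> rat" and C :: rat
    assume "(\<forall>i\<in>{1..n}. w i > 0 \<and> \<mu> i \<ge> 0 \<and> c i \<ge> 0) \<and> C \<ge> 0"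
    then interpret outlier_instance n w \<mu> c C by unfold_locales auto
    show "\<exists>t s S.
          run outlier_program (initial_store (encode_instance n w \<mu> c C)) t s \<and>
          t \<le> poly p (input_size (encode_instance n w \<mu> c C)) \<and>
          outputs_set n s S \<and>
          (\<Sum>i\<in>S. c i) \<le> 3 * C \<and>
          completion_cost n w \<mu> S \<le> 3 * G_star n w \<mu> c C"
      using outlier_program_correct
      unfolding good_def input_def[symmetric] N_def[symmetric] p L_def by blast
  qed
qed

end
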